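(* Let $\alpha\in\left(-\tfrac13,\tfrac12\right)$ and let $(X_k)_{k\ge 0}$ be the elephant random walk on $\mathbb{Z}^2$ with memory parameter $\alpha$, started from $X_0=\mathbf{0}=(0,0)$. Then $(X_k)_{k\ge 0}$ is recurrent, i.e. almost surely $X_k=\mathbf{0}$ for infinitely many $k\ge 0$.
   Context: Let $\mathbf{e}_1,\mathbf{e}_2,\mathbf{e}_3,\mathbf{e}_4$ be the four unit direction vectors $(\pm1,0),(0,\pm1)$ of $\mathbb{Z}^2$. For a nearest-neighbour process $(X_k)_{k\ge0}$ on $\mathbb{Z}^2$ with $X_0=\mathbf{0}$, write $\Delta X_k=X_{k+1}-X_k\in\{\mathbf{e}_1,\dots,\mathbf{e}_4\}$, let $\mathcal{F}_n$ be the $\sigma$-field generated by the first $n$ steps, and define the centered counting direction processes $$D^{[X]}_k(\mathbf{e}_i)=\sum_{j=0}^{k-1}\mathbf{1}\{X_{j+1}-X_j=\mathbf{e}_i\}-\frac{k}{4},\qquad 1\le i\le 4.$$ For $\alpha\in(-\frac13,1)$, the elephant random walk on $\mathbb{Z}^2$ with memory parameter $\alpha$ is the process whose law satisfies, for all $n\ge 0$ and $1\le i\le 4$, $$\mathbb{P}(\Delta X_n=\mathbf{e}_i\mid\mathcal{F}_n)=\frac14+\alpha\,\frac{D^{[X]}_n(\mathbf{e}_i)}{n},$$ with the convention $0/0=0$ for $n=0$. The range $\alpha<\frac12$ is called the diffusive regime. *)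

theory Defs
  imports "HOL-Probability.Probability"
begin

definition unit_directions :: "(int \<times> int) set" where
  "unit_directions = {(1, 0), (-1, 0), (0, 1), (0, -1)}"

definition walk_step :: "(nat \<Rightarrow> 'a \<Rightarrow> int \<times> int) \<Rightarrow> nat \<Rightarrow> 'a \<Rightarrow> int \<times> int" where
  "walk_step X k \<omega> = X (Suc k) \<omega> - X k \<omega>"

text \<open>The \<open>\<sigma>\<close>-field generated by the first \<open>n\<close> steps, as a measure-space object on
  \<open>space M\<close>; for \<open>n = 0\<close> it is the trivial \<open>\<sigma>\<close>-field.\<close>

definition step_sigma ::
  "'a measure \<Rightarrow> (nat \<Rightarrow> 'a \<Rightarrow> int \<times> int) \<Rightarrow> nat \<Rightarrow> 'a measure" where
  "step_sigma M X n =
     sigma (space M) {walk_step X j -` A \<inter> space M | j A. j < n}"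

definition centered_count ::
  "(nat \<Rightarrow> 'a \<Rightarrow> int \<times> int) \<Rightarrow> nat \<Rightarrow> int \<times> int \<Rightarrow> 'a \<Rightarrow> real" where
  "centered_count X k e \<omega> =
     (\<Sum>j<k. if walk_step X j \<omega> = e then 1 else 0) - real k / 4"

text \<open>At \<open>n = 0\<close> the last assumption gives probability \<open>1/4\<close> to each direction, since
  \<open>0 / 0 = 0\<close> in type \<^typ>\<open>real\<close>. The starting point and the nearest-neighbour
  property are only required almost surely, so being an elephant random walk depends on
  the law of the process alone.\<close>

locale elephant_random_walk = prob_space M
  for M :: "'a measure" and \<alpha> :: real and X :: "nat \<Rightarrow> 'a \<Rightarrow> int \<times> int" +
  assumes memory_gt: "- 1 / 3 < \<alpha>"
    and memory_less: "\<alpha> < 1"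
    and measurable_walk: "\<And>k. X k \<in> measurable M (count_space UNIV)"
    and start_origin: "AE \<omega> in M. X 0 \<omega> = (0, 0)"
    and nearest_neighbour: "\<And>k. AE \<omega> in M. walk_step X k \<omega> \<in> unit_directions"
    and step_law: "\<And>n e. e \<in> unit_directions \<Longrightarrow>
      (AE \<omega> in M.
        real_cond_exp M (step_sigma M X n)
          (indicat_real {\<omega>' \<in> space M. walk_step X n \<omega>' = e}) \<omega>
        = 1 / 4 + \<alpha> * (centered_count X n e \<omega> / real n))"
begin

lemma measurable_walk_step [measurable]:
  "walk_step X k \<in> measurable M (count_space UNIV)"
proof -
  have "(\<lambda>\<omega>. (\<lambda>(x, y). x - y) (X (Suc k) \<omega>, X k \<omega>)) \<in> measurable M (count_space UNIV)"
    by (rule measurable_compose_countable'[where I = UNIV and g = "X k"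
          and f = "\<lambda>y \<omega>. (\<lambda>(x, y). x - y) (X (Suc k) \<omega>, y)"])
       (auto intro: measurable_compose[OF measurable_walk] measurable_walk)
  then show ?thesis by (simp add: walk_step_def[abs_def])
qed

lemma subalgebra_step_sigma: "subalgebra M (step_sigma M X n)"
  unfolding subalgebra_def step_sigma_def
  by (subst sets_measure_of)
     (auto intro!: sets.sigma_sets_subset measurable_sets[OF measurable_walk_step]
           simp: space_measure_of_conv)

end

end

theory Submission
  imports Defs
begin

text \<open>Along a path on which the vector \<open>D\<^sub>k\<close> of centered counts stays of order \<open>\<surd>k\<close> for
  \<open>n \<le> k \<le> 2 n\<close>, the law of the elephant walk is comparable to that of simple random walk: a step in
  direction \<open>e\<close> changes the logarithm of the likelihood ratio by about \<open>4 \<alpha> D\<^sub>k(e) / k\<close>, and as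
  \<open>2 D\<^sub>k(e)\<close> is the increment of \<open>|D|\<^sup>2\<close> up to a constant, summation by parts bounds the logarithm by the
  size of \<open>|D|\<^sup>2 / n\<close>. By the second moment method simple random walk started within \<open>O(\<surd>n)\<close> of the origin
  hits it in the time window \<open>[n, 2 n]\<close> along such a path with probability at least \<open>c / log n\<close>; hence so does
  the elephant walk whenever \<open>|D\<^sub>n|\<^sup>2 \<le> K n\<close>. In the diffusive regime \<open>E |D\<^sub>n|\<^sup>2 = O(n)\<close>, so this condition fails
  with probability \<open>O(1 / K)\<close>. Over the dyadic scales the lower bounds \<open>c / log n\<close> form a divergent
  harmonic series, which pushes the probability of avoiding the origin from some time on below \<open>O(1 / K)\<close>, for
  every \<open>K\<close>.\<close>

section \<open>Paths and endpoint counts\<close>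

definition paths :: "nat \<Rightarrow> (int \<times> int) list set" where
  "paths n = {g. length g = n \<and> set g \<subseteq> unit_directions}"

lemma finite_unit_directions [simp]: "finite unit_directions"
  by (simp add: unit_directions_def)

lemma sum_unit_directions:
  "(\<Sum>e\<in>unit_directions. f e) = f (1,0) + f (-1,0) + f (0,1) + f (0,-1)"
  for f :: "int \<times> int \<Rightarrow> 'b::comm_monoid_add"
  by (simp add: unit_directions_def add.assoc)

lemma card_unit_directions [simp]: "card unit_directions = 4"
  by (simp add: unit_directions_def)

lemma paths_0 [simp]: "paths 0 = {[]}"
  by (auto simp: paths_def)

lemma finite_paths [simp]: "finite (paths n)"
  using finite_lists_length_eq[OF finite_unit_directions, of n]
  by (simp add: paths_def conj_commute)

lemma sum_paths_Cons:
  "(\<Sum>g\<in>paths (Suc m). f g) = (\<Sum>e\<in>unit_directions. \<Sum>g\<in>paths m. f (e # g))"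
  for f :: "(int \<times> int) list \<Rightarrow> 'b::comm_monoid_add"
proof -
  have "paths (Suc m) = (\<lambda>(e, g). e # g) ` (unit_directions \<times> paths m)"
    by (auto simp: paths_def image_iff length_Suc_conv)
  moreover have "inj_on (\<lambda>(e, g). e # g) (unit_directions \<times> paths m)"
    by (auto simp: inj_on_def)
  ultimately show ?thesis
    unfolding case_prod_unfold
    by (simp add: sum.reindex sum.cartesian_product case_prod_unfold)
qed

lemma sum_paths_append:
  "(\<Sum>g\<in>paths (a + b). f g) = (\<Sum>u\<in>paths a. \<Sum>v\<in>paths b. f (u @ v))"
  for f :: "(int \<times> int) list \<Rightarrow> 'b::comm_monoid_add"
  by (induction a arbitrary: f) (simp_all add: sum_paths_Cons)

lemma sum_paths_snoc:
  "(\<Sum>g\<in>paths (Suc m). f g) = (\<Sum>g\<in>paths m. \<Sum>e\<in>unit_directions. f (g @ [e]))"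
  for f :: "(int \<times> int) list \<Rightarrow> 'b::comm_monoid_add"
  using sum_paths_append[of f m 1] by (simp add: sum_paths_Cons)

lemma card_paths [simp]: "card (paths m) = 4 ^ m"
proof -
  have "(\<Sum>g\<in>paths m. 1::nat) = 4 ^ m"
    by (induction m) (simp_all add: sum_paths_Cons del: sum_constant, simp)
  then show ?thesis by simp
qed

lemma length_paths: "g \<in> paths m \<Longrightarrow> length g = m"
  by (simp add: paths_def)

section \<open>Walks on the line with steps 1 and -1, counted by endpoint\<close>

primrec signed_walks :: "nat \<Rightarrow> int \<Rightarrow> nat" where
  "signed_walks 0 a = (if a = 0 then 1 else 0)"
| "signed_walks (Suc m) a = signed_walks m (a - 1) + signed_walks m (a + 1)"

lemma signed_walks_support:
  "signed_walks m a \<noteq> 0 \<Longrightarrow> \<exists>r. a = 2 * int r - int m"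
proof (induction m arbitrary: a)
  case (Suc m)
  then consider "signed_walks m (a - 1) \<noteq> 0" | "signed_walks m (a + 1) \<noteq> 0" by fastforce
  then show ?case
  proof cases
    case 1
    with Suc.IH obtain r where "a - 1 = 2 * int r - int m" by blast
    then have "a = 2 * int (Suc r) - int (Suc m)" by simp
    then show ?thesis by blast
  next
    case 2
    with Suc.IH obtain r where "a + 1 = 2 * int r - int m" by blast
    then have "a = 2 * int r - int (Suc m)" by simp
    then show ?thesis by blast
  qed
qed (auto split: if_splits intro: exI[of _ 0])

lemma signed_walks_binomial: "signed_walks m (2 * int r - int m) = m choose r"
proof (induction m arbitrary: r)
  case (Suc m)
  show ?case
  proof (cases r)
    case 0
    have "signed_walks m (- int m - 2) = 0"
      using signed_walks_support[of m "- int m - 2"] by fastforce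
    with Suc.IH[of 0] 0 show ?thesis by (simp add: algebra_simps)
  next
    case (Suc s)
    have "2 * int r - int (Suc m) - 1 = 2 * int s - int m"
      "2 * int r - int (Suc m) + 1 = 2 * int r - int m" using Suc by auto
    then have "signed_walks (Suc m) (2 * int r - int (Suc m)) = (m choose s) + (m choose r)"
      by (simp only: signed_walks.simps Suc.IH)
    then show ?thesis using Suc by simp
  qed
qed simp

text \<open>The coordinates \<open>x + y\<close> and \<open>x - y\<close> of the planar walk are two independent signed walks.\<close>

lemma paths_endpoint_count:
  "(\<Sum>g\<in>paths m. of_bool (sum_list g = (x, y))) = signed_walks m (x + y) * signed_walks m (x - y)"
proof (induction m arbitrary: x y)
  case (Suc m)
  have eq: "(e + s = (x, y)) = (s = (x - fst e, y - snd e))" for e s :: "int \<times> int"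
    by (cases e; cases s) auto
  show ?case
    by (simp add: sum_paths_Cons eq Suc.IH sum_unit_directions)
       (simp add: algebra_simps)
qed (auto simp: zero_prod_def)

section \<open>Bounds for central binomial coefficients\<close>

lemma central_binomial_Suc:
  "real ((2 * Suc l) choose Suc l) = real ((2 * l) choose l) * (2 * (2 * real l + 1) / (l + 1))"
proof -
  have a: "Suc l * (Suc (Suc (2 * l)) choose Suc l) = Suc (Suc (2 * l)) * (Suc (2 * l) choose l)"
    by (rule Suc_times_binomial)
  have b: "Suc l * (Suc (2 * l) choose l) = Suc (2 * l) * ((2 * l) choose l)"
    using Suc_times_binomial_add[of l l] Suc_times_binomial[of "2 * l" l]
    by (metis Suc_times_binomial_add add_Suc_right mult_2 Suc_times_binomial)
  have "Suc (Suc (2 * l)) = 2 * Suc l" by simp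
  then have "Suc l * ((2 * Suc l) choose Suc l) = 2 * (2 * l + 1) * ((2 * l) choose l)" using a b
    by (metis (no_types, lifting) Suc_eq_plus1 mult.assoc mult_Suc_right add_2_eq_Suc')
  then have "real (Suc l) * real ((2 * Suc l) choose Suc l) = 2 * (2 * real l + 1) * real ((2 * l) choose l)"
    by (metis (mono_tags, opaque_lifting) of_nat_mult of_nat_add of_nat_1 of_nat_numeral)
  then show ?thesis by (simp add: field_simps del: binomial_Suc_Suc)
qed

text \<open>After multiplication by the squared ratio of consecutive central coefficients, the
  induction step is \<open>(2 l + 1) (2 l + 3) \<le> (2 l + 2)^2\<close>.\<close>

lemma central_binomial_square_upper:
  "real ((2 * l) choose l) ^ 2 * real (2 * l + 1) \<le> 16 ^ l"
proof (induction l)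
  case (Suc l)
  have "(2 * (2 * real l + 1) / (l + 1))\<^sup>2 * (2 * real l + 3) \<le> 16 * (2 * real l + 1)"
    by (simp add: divide_simps power2_eq_square) (simp add: algebra_simps)
  then have "real ((2 * l) choose l) ^ 2 * ((2 * (2 * real l + 1) / (l + 1))\<^sup>2 * (2 * real l + 3))
      \<le> real ((2 * l) choose l) ^ 2 * (16 * (2 * real l + 1))"
    by (rule mult_left_mono) simp
  also have "\<dots> \<le> 16 ^ Suc l" using Suc.IH by (simp add: algebra_simps)
  finally have "(real ((2 * l) choose l) * (2 * (2 * real l + 1) / (l + 1)))\<^sup>2 * (2 * real l + 3) \<le> 16 ^ Suc l"
    by (simp only: power_mult_distrib mult.assoc)
  moreover have "real (2 * Suc l + 1) = 2 * real l + 3" by simp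
  ultimately show ?case unfolding central_binomial_Suc by (simp only:)
qed simp


text \<open>The same induction, now resting on \<open>4 l (l + 1) \<le> (2 l + 1)^2\<close>.\<close>

lemma central_binomial_square_lower:
  "l > 0 \<Longrightarrow> 16 ^ l \<le> 4 * real l * real ((2 * l) choose l) ^ 2"
proof (induction l rule: nat_induct_non_zero)
  case (Suc l)
  have "16 * real l \<le> (2 * (2 * real l + 1) / (l + 1))\<^sup>2 * (real l + 1)"
    by (simp add: divide_simps power2_eq_square) (simp add: algebra_simps)
  then have "real ((2 * l) choose l) ^ 2 * (16 * real l)
      \<le> real ((2 * l) choose l) ^ 2 * ((2 * (2 * real l + 1) / (l + 1))\<^sup>2 * (real l + 1))"
    by (rule mult_left_mono) simp
  then have "16 ^ Suc l
      \<le> 4 * (real ((2 * l) choose l) ^ 2 * (2 * (2 * real l + 1) / (l + 1))\<^sup>2) * (real l + 1)"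
    using Suc.IH by (simp add: algebra_simps)
  moreover have "real ((2 * Suc l) choose Suc l) = real ((2 * l) choose l) * (2 * (2 * real l + 1) / (l + 1))"
    by (rule central_binomial_Suc)
  ultimately show ?case by (simp only: power_mult_distrib) (simp add: algebra_simps)
qed simp

section \<open>Local limit bounds for the endpoint of planar paths\<close>

definition endpoint_count :: "nat \<Rightarrow> int \<times> int \<Rightarrow> real" where
  "endpoint_count m x = (\<Sum>g\<in>paths m. of_bool (sum_list g = x))"

lemma endpoint_count_eq:
  "endpoint_count m x = real (signed_walks m (fst x + snd x)) * real (signed_walks m (fst x - snd x))"
proof -
  have "endpoint_count m x = real (\<Sum>g\<in>paths m. of_bool (sum_list g = (fst x, snd x)))"
    unfolding endpoint_count_def of_nat_sum by simp
  then show ?thesis by (simp only: paths_endpoint_count of_nat_mult)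
qed

lemma endpoint_count_Suc:
  "endpoint_count (Suc m) x = (\<Sum>e\<in>unit_directions. endpoint_count m (x - e))"
  unfolding endpoint_count_def
  by (subst sum_paths_Cons) (auto intro!: sum.cong simp: algebra_simps)

lemma endpoint_count_nonneg: "endpoint_count m x \<ge> 0"
  by (simp add: endpoint_count_def sum_nonneg)

lemma signed_walks_le_central: "signed_walks (2 * l) a \<le> (2 * l) choose l"
proof (cases "signed_walks (2 * l) a = 0")
  case False
  then obtain r where "a = 2 * int r - int (2 * l)" using signed_walks_support by blast
  then show ?thesis
    using signed_walks_binomial[of "2 * l" r] binomial_maximum'[of l r] by (simp add: mult.commute)
qed simp

lemma endpoint_count_even_upper: "endpoint_count (2 * l) x \<le> 4 ^ (2 * l) / real (2 * l + 1)"
proof -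
  have "endpoint_count (2 * l) x \<le> real ((2 * l) choose l) * real ((2 * l) choose l)"
    unfolding endpoint_count_eq by (intro mult_mono) (simp_all add: signed_walks_le_central)
  also have "\<dots> \<le> 16 ^ l / real (2 * l + 1)"
    using central_binomial_square_upper[of l] by (simp add: field_simps power2_eq_square)
  finally show ?thesis by (simp add: power_mult)
qed

text \<open>The even bound carries \<open>2 * l + 1\<close> rather than \<open>2 * l\<close>, so
  that one more step gives \<open>4 * 4 ^ (2 * l) / (2 * l + 1)\<close>, exactly the claim at the
  odd time.\<close>

lemma endpoint_count_upper:
  assumes "m > 0"
  shows "endpoint_count m x \<le> 4 ^ m / real m"
proof (cases "even m")
  case True
  then obtain l where l: "m = 2 * l" by blast
  have "endpoint_count m x \<le> 4 ^ m / real (m + 1)"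
    using endpoint_count_even_upper[of l x] l by simp
  also have "\<dots> \<le> 4 ^ m / real m" using assms by (intro divide_left_mono) auto
  finally show ?thesis .
next
  case False
  then obtain l where l: "m = Suc (2 * l)" using oddE by fastforce
  have "endpoint_count m x \<le> (\<Sum>e\<in>unit_directions. 4 ^ (2 * l) / real (2 * l + 1))"
    unfolding l endpoint_count_Suc by (intro sum_mono endpoint_count_even_upper)
  then show ?thesis by (simp add: l)
qed

text \<open>Consecutive coefficients have ratio \<open>(l - s) / (l + s + 1)\<close>, which for
  \<open>s < t\<close> is at least \<open>1 - 2 t / l\<close> and hence at least
  \<open>exp (- 4 t / l)\<close>; the product of \<open>t\<close> such ratios gives the Gaussian
  factor. The hypothesis keeps \<open>2 t / l\<close> within \<open>1 / 2\<close>, where the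
  logarithm bound applies.\<close>

lemma binomial_shift_lower:
  assumes "4 * t \<le> l"
  shows "real ((2 * l) choose l) * exp (- 4 * real t ^ 2 / real l) \<le> real ((2 * l) choose (l + t))"
proof (cases "t = 0")
  case False
  then have l: "l > 0" using assms by simp
  have step: "real ((2 * l) choose (l + s)) * exp (- 4 * real t / real l) \<le> real ((2 * l) choose (l + Suc s))"
    if "s < t" for s
  proof -
    have sl: "s < l" using that assms by simp
    have "Suc (l + s) * ((2 * l) choose Suc (l + s)) = (2 * l - (l + s)) * ((2 * l) choose (l + s))"
      using binomial_absorb_comp[of "2*l" "l+s"] binomial_absorption[of "l+s" "2*l"] by simp
    then have "real (Suc (l + s)) * real ((2 * l) choose Suc (l + s)) = (real l - real s) * real ((2 * l) choose (l + s))"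
      using sl by (metis (no_types, lifting) add_diff_cancel_left diff_add_inverse diff_diff_left less_imp_le mult_2 of_nat_diff of_nat_mult)
    then have e: "real ((2 * l) choose (l + Suc s)) = real ((2 * l) choose (l + s)) * ((real l - real s) / (real l + real s + 1))"
      by (simp add: field_simps)
    have le: "2 * real t / real l \<le> 1/2" using assms l by (simp add: field_simps)
    have "exp (- 2 * (2 * real t / real l)) \<le> 1 - 2 * real t / real l"
    proof -
      have "- 2 * (2 * real t / real l) \<le> ln (1 - 2 * real t / real l)"
      proof -
        let ?x = "2 * real t / real l"
        have "- ?x - 2 * ?x\<^sup>2 \<le> ln (1 - ?x)" by (rule ln_one_minus_pos_lower_bound) (use le in auto)
        moreover have "2 * ?x\<^sup>2 \<le> ?x"
        proof -
          have "?x * ?x \<le> ?x * (1/2)" by (rule mult_left_mono[OF le]) simp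
          then show ?thesis by (simp add: power2_eq_square)
        qed
        ultimately show ?thesis by linarith
      qed
      moreover have "1 - 2 * real t / real l > 0" using le by linarith
      ultimately show ?thesis by (metis exp_le_cancel_iff exp_ln)
    qed
    also have "1 - 2 * real t / real l \<le> (real l - real s) / (real l + real s + 1)"
    proof -
      have st: "real s + 1 \<le> real t" using that by simp
      have "(1 - 2 * real t / real l) * (real l + real s + 1) \<le> (1 - 2 * real t / real l) * (real l + real t)"
        by (intro mult_left_mono) (use st le in linarith)+
      also have "\<dots> \<le> real l - real t" using l by (simp add: field_simps)
      also have "\<dots> \<le> real l - real s" using st by simp
      finally show ?thesis by (simp add: le_divide_eq)
    qed
    finally have "exp (- 4 * real t / real l) \<le> (real l - real s) / (real l + real s + 1)" by simp
    then show ?thesis unfolding e by (intro mult_left_mono) simp_all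
  qed
  have "real ((2 * l) choose l) * exp (- 4 * real t / real l) ^ s \<le> real ((2 * l) choose (l + s))" if "s \<le> t" for s
    using that
  proof (induction s)
    case (Suc s)
    then have "real ((2 * l) choose l) * exp (- 4 * real t / real l) ^ s * exp (- 4 * real t / real l)
        \<le> real ((2 * l) choose (l + s)) * exp (- 4 * real t / real l)"
      by (intro mult_right_mono) auto
    also have "\<dots> \<le> real ((2 * l) choose (l + Suc s))" by (rule step) (use Suc.prems in simp)
    finally show ?case by (simp only: power_Suc2 mult.assoc)
  qed simp
  from this[of t] show ?thesis
    by (simp add: exp_of_nat_mult[symmetric] power2_eq_square mult.left_commute)
qed simp

text \<open>With \<open>a = 2 b\<close> the count is the binomial coefficient at distance
  \<open>t = |b|\<close> from the centre. The size bound on \<open>a\<close> makes the exponent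
  \<open>4 t^2 / l\<close> at most \<open>K\<close> and, with \<open>4 K \<le> l\<close>, also gives
  \<open>4 t \<le> l\<close>.\<close>

lemma signed_walks_lower:
  assumes "even a" "real_of_int a ^ 2 \<le> K * real l" "4 * K \<le> real l" "l > 0"
  shows "real ((2 * l) choose l) * exp (- K) \<le> real (signed_walks (2 * l) a)"
proof -
  obtain b where b: "a = 2 * b" using assms(1) by blast
  define t where "t = nat \<bar>b\<bar>"
  have t2: "4 * real t ^ 2 \<le> K * real l" using assms(2) by (simp add: b t_def power2_eq_square)
  have "(4 * real t)\<^sup>2 \<le> real l ^ 2"
  proof -
    have "4 * K * real l \<le> real l * real l" using assms(3) by (intro mult_right_mono) auto
    then show ?thesis using t2 by (simp add: power2_eq_square)
  qed
  then have "4 * real t \<le> real l" by (rule power2_le_imp_le) simp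
  then have tl: "4 * t \<le> l" by linarith
  have "4 * real t ^ 2 / real l \<le> K" using t2 assms(4) by (simp add: field_simps)
  then have "real ((2 * l) choose l) * exp (- K) \<le> real ((2 * l) choose l) * exp (- 4 * real t ^ 2 / real l)"
    by (intro mult_left_mono) auto
  also have "\<dots> \<le> real ((2 * l) choose (l + t))" by (rule binomial_shift_lower[OF tl])
  also have "(2 * l) choose (l + t) = signed_walks (2 * l) a"
  proof (cases "b \<ge> 0")
    case True
    then show ?thesis using signed_walks_binomial[of "2 * l" "l + t"] by (simp add: b t_def)
  next
    case False
    then have "(2 * l) choose (l - t) = signed_walks (2 * l) a"
      using signed_walks_binomial[of "2 * l" "l - t"] tl by (simp add: b t_def of_nat_diff)
    moreover have "(2 * l) choose (l + t) = (2 * l) choose (l - t)"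
      using tl by (subst binomial_symmetric) auto
    ultimately show ?thesis by simp
  qed
  finally show ?thesis .
qed

text \<open>Each of the two rotated coordinates costs only a factor \<open>exp (- K)\<close> against
  the central coefficient, whose square is at least \<open>16 ^ l / (4 l)\<close>. The parity of
  \<open>x + y\<close> is also that of \<open>x - y\<close>.\<close>

lemma endpoint_count_lower:
  assumes "even (x + y)" "real_of_int (x + y) ^ 2 \<le> K * real l" "real_of_int (x - y) ^ 2 \<le> K * real l"
    and "4 * K \<le> real l" "l > 0"
  shows "exp (- 2 * K) / (4 * real l) * 4 ^ (2 * l) \<le> endpoint_count (2 * l) (x, y)"
proof -
  let ?C = "real ((2 * l) choose l)"
  have four: "4 ^ (l * 2) = (16 :: real) ^ l" by (simp add: power_mult mult.commute[of l])
  have "exp (- 2 * K) / (4 * real l) * 4 ^ (2 * l) \<le> exp (- 2 * K) * ?C ^ 2"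
    using central_binomial_square_lower[OF assms(5)] assms(5) four
    by (simp add: field_simps)
  also have "\<dots> = (?C * exp (- K)) * (?C * exp (- K))"
    by (simp add: power2_eq_square exp_add[symmetric])
  also have "\<dots> \<le> endpoint_count (2 * l) (x, y)"
    unfolding endpoint_count_eq fst_conv snd_conv
    using assms by (intro mult_mono signed_walks_lower) auto
  finally show ?thesis .
qed

section \<open>Deviation of the step counts\<close>

text \<open>For \<open>g\<close> the list of the first \<open>k\<close> steps this is the centered
  count at time \<open>k\<close>. As a function of lists it is additive under concatenation, which
  lets a path be split into history and continuation.\<close>

definition dev :: "(int \<times> int) list \<Rightarrow> int \<times> int \<Rightarrow> real" where
  "dev g e = real (count_list g e) - real (length g) / 4"

definition spread :: "(int \<times> int) list \<Rightarrow> real" where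
  "spread g = (\<Sum>e\<in>unit_directions. (dev g e)\<^sup>2)"

lemma dev_append: "dev (u @ v) e = dev u e + dev v e"
  by (simp add: dev_def field_simps)

lemma dev_Nil [simp]: "dev [] e = 0"
  by (simp add: dev_def)

lemma spread_Nil [simp]: "spread [] = 0"
  by (simp add: spread_def)

lemma spread_nonneg: "spread g \<ge> 0"
  by (simp add: spread_def sum_nonneg)

lemma spread_append_le: "spread (u @ v) \<le> 2 * spread u + 2 * spread v"
proof -
  have "(a + b)\<^sup>2 \<le> 2 * a\<^sup>2 + 2 * b\<^sup>2" for a b :: real
    using zero_le_power2[of "a - b"] by (simp add: power2_eq_square algebra_simps)
  then have "spread (u @ v) \<le> (\<Sum>e\<in>unit_directions. 2 * (dev u e)\<^sup>2 + 2 * (dev v e)\<^sup>2)"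
    unfolding spread_def dev_append by (intro sum_mono) auto
  then show ?thesis by (simp add: spread_def sum.distrib sum_distrib_left)
qed

lemma spread_append3_le: "spread (u @ v @ w) \<le> 3 * (spread u + spread v + spread w)"
proof -
  have "(a + (b + c))\<^sup>2 \<le> 3 * (a\<^sup>2 + b\<^sup>2 + c\<^sup>2)" for a b c :: real
    using zero_le_power2[of "a - b"] zero_le_power2[of "a - c"] zero_le_power2[of "b - c"]
    by (simp add: power2_eq_square algebra_simps)
  then have "spread (u @ v @ w)
      \<le> (\<Sum>e\<in>unit_directions. 3 * ((dev u e)\<^sup>2 + (dev v e)\<^sup>2 + (dev w e)\<^sup>2))"
    unfolding spread_def dev_append by (intro sum_mono) auto
  then show ?thesis by (simp only: spread_def sum.distrib sum_distrib_left[symmetric])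
qed

lemma sum_dev:
  assumes "set g \<subseteq> unit_directions"
  shows "(\<Sum>e\<in>unit_directions. dev g e) = 0"
proof -
  have "(\<Sum>e\<in>unit_directions. count_list g e) = length g"
  proof -
    have "length g = (\<Sum>e\<in>set g. count_list g e)" by (simp add: sum_count_set[OF subset_refl])
    also have "\<dots> = (\<Sum>e\<in>unit_directions. count_list g e)"
      using assms by (intro sum.mono_neutral_left) (auto simp: count_list_0_iff)
    finally show ?thesis by simp
  qed
  then have "(\<Sum>e\<in>unit_directions. real (count_list g e)) = real (length g)"
    by (metis of_nat_sum)
  then show ?thesis by (simp add: dev_def sum_subtractf)
qed

text \<open>A step in direction \<open>e\<close> adds to the vector of deviations the vector with
  entry \<open>3/4\<close> at \<open>e\<close> and \<open>-1/4\<close> elsewhere, of squared norm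
  \<open>3/4\<close>. Because the deviations sum to 0, the cross term is \<open>2 * dev g e\<close>
  alone. The identity underlies the mean spread, the second moment of the elephant walk and the
  likelihood ratio.\<close>

lemma spread_snoc:
  assumes "set g \<subseteq> unit_directions" "e \<in> unit_directions"
  shows "spread (g @ [e]) = spread g + 2 * dev g e + 3 / 4"
proof -
  have d: "dev [e] a = of_bool (a = e) - 1 / 4" for a
    by (auto simp: dev_def)
  have "spread (g @ [e]) = (\<Sum>a\<in>unit_directions. (dev g a)\<^sup>2 + (2 * of_bool (a = e) * dev g a
        - dev g a / 2 + (of_bool (a = e) / 2 + 1 / 16)))"
    unfolding spread_def dev_append d
    by (intro sum.cong refl) (auto simp: power2_eq_square field_simps)
  also have "\<dots> = spread g + ((\<Sum>a\<in>unit_directions. 2 * of_bool (a = e) * dev g a)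
     - (\<Sum>a\<in>unit_directions. dev g a) / 2
     + ((\<Sum>a\<in>unit_directions. of_bool (a = e)) / 2 + 1 / 4))"
    by (simp add: sum.distrib sum_subtractf spread_def sum_divide_distrib del: sum_of_bool_eq sum_mult_of_bool_eq sum_of_bool_mult_eq)
  also have "(\<Sum>a\<in>unit_directions. 2 * of_bool (a = e) * dev g a) = 2 * dev g e"
  proof -
    have "(\<Sum>a\<in>unit_directions. 2 * of_bool (a = e) * dev g a)
        = (\<Sum>a\<in>unit_directions. if a = e then 2 * dev g e else 0)"
      by (intro sum.cong) auto
    then show ?thesis using assms(2) by simp
  qed
  also have "(\<Sum>a\<in>unit_directions. of_bool (a = e)) = (1::real)"
    using assms(2) by (simp add: of_bool_def)
  finally show ?thesis using sum_dev[OF assms(1)] by simp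
qed

section \<open>Mean spread under the uniform measure on paths\<close>

lemma sum_spread_paths: "(\<Sum>g\<in>paths m. spread g) = 3 / 4 * real m * 4 ^ m"
proof (induction m)
  case (Suc m)
  have "(\<Sum>g\<in>paths (Suc m). spread g) = (\<Sum>g\<in>paths m. \<Sum>e\<in>unit_directions. spread g + 2 * dev g e + 3 / 4)"
    unfolding sum_paths_snoc by (intro sum.cong refl spread_snoc) (auto simp: paths_def)
  also have "\<dots> = (\<Sum>g\<in>paths m. 4 * spread g + 3)"
  proof (intro sum.cong refl)
    fix g assume "g \<in> paths m"
    then have "(\<Sum>e\<in>unit_directions. 2 * dev g e) = 0"
      using sum_dev[of g] by (simp add: paths_def sum_distrib_left[symmetric])
    then show "(\<Sum>e\<in>unit_directions. spread g + 2 * dev g e + 3 / 4) = 4 * spread g + 3"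
      by (simp add: sum.distrib)
  qed
  also have "\<dots> = 3 / 4 * real (Suc m) * 4 ^ Suc m"
    by (simp add: sum.distrib sum_distrib_left[symmetric] Suc.IH) (simp add: algebra_simps)
  finally show ?case .
qed simp

lemma sum_spread_take_le: "(\<Sum>g\<in>paths m. spread (take j g)) \<le> real m * 4 ^ m"
proof (cases "j \<le> m")
  case True
  have "(\<Sum>g\<in>paths (j + (m - j)). spread (take j g)) = (\<Sum>u\<in>paths j. \<Sum>v\<in>paths (m - j). spread u)"
    unfolding sum_paths_append by (intro sum.cong refl) (auto simp: length_paths)
  also have "\<dots> = 4 ^ (m - j) * (3 / 4 * real j * 4 ^ j)"
    by (simp add: sum_distrib_left[symmetric] sum_spread_paths)
  also have "\<dots> = 3 / 4 * real j * 4 ^ (j + (m - j))"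
    by (simp add: power_add)
  also have "\<dots> \<le> real m * 4 ^ m"
    using True by (intro mult_mono) auto
  finally show ?thesis using True by simp
next
  case False
  have "(\<Sum>g\<in>paths m. spread (take j g)) = (\<Sum>g\<in>paths m. spread g)"
    using False by (intro sum.cong refl) (simp add: length_paths)
  then have "(\<Sum>g\<in>paths m. spread (take j g)) = 3 / 4 * real m * 4 ^ m"
    by (simp only: sum_spread_paths)
  also have "\<dots> \<le> real m * 4 ^ m" by (intro mult_right_mono) auto
  finally show ?thesis .
qed

text \<open>Of the three blocks into which the path is cut, each of the first two is independent of
  the other one, which alone keeps the probability of the endpoint condition of order \<open>1 / l\<close>.\<close>

lemma sum_spread_bridge_le:
  assumes "l > 0" "r \<le> 2 * l"
  shows "(\<Sum>g\<in>paths (2 * l + r). spread (take j g) * of_bool (sum_list (take (2 * l) g) = y))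
    \<le> 9 * 4 ^ (2 * l + r)"
proof -
  let ?I = "\<lambda>u v. of_bool (sum_list u + sum_list v = y) :: real"
  \<comment> \<open>The blocks have lengths \<open>l\<close>, \<open>l\<close> and \<open>r\<close>;
    truncated subtraction makes the prefix of a block empty when the cut \<open>j\<close> comes
    before it.\<close>
  let ?a = "\<lambda>u. spread (take j u)" and ?b = "\<lambda>v. spread (take (j - l) v)"
    and ?c = "\<lambda>w. spread (take (j - (l + l)) w)"
  let ?N = "4 ^ (2 * l + r) :: real"
  have N: "?N = 4 ^ l * 4 ^ l * 4 ^ r" by (simp add: power_add mult_2)
  have split: "2 * l + r = l + (l + r)" by simp
  have "(\<Sum>g\<in>paths (2 * l + r). spread (take j g) * of_bool (sum_list (take (2 * l) g) = y))
      = (\<Sum>u\<in>paths l. \<Sum>v\<in>paths l. \<Sum>w\<in>paths r.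
          spread (take j u @ take (j - l) v @ take (j - (l + l)) w) * ?I u v)"
    unfolding split sum_paths_append
    by (intro sum.cong refl) (auto simp: length_paths mult_2)
  also have "\<dots> \<le> (\<Sum>u\<in>paths l. \<Sum>v\<in>paths l. \<Sum>w\<in>paths r.
      3 * (?a u + ?b v + ?c w) * ?I u v)"
    by (intro sum_mono mult_right_mono spread_append3_le) simp
  also have "\<dots> = 3 * ((\<Sum>u\<in>paths l. \<Sum>v\<in>paths l. \<Sum>w\<in>paths r. ?a u * ?I u v)
      + (\<Sum>u\<in>paths l. \<Sum>v\<in>paths l. \<Sum>w\<in>paths r. ?b v * ?I u v)
      + (\<Sum>u\<in>paths l. \<Sum>v\<in>paths l. \<Sum>w\<in>paths r. ?c w * ?I u v))"
    by (simp only: sum.distrib[symmetric] sum_distrib_left ring_distribs mult.assoc)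
  also have "\<dots> \<le> 3 * (?N + ?N + ?N)"
  proof (intro mult_left_mono add_mono)
    \<comment> \<open>Summing over \<open>v\<close> first: for every \<open>u\<close> at most
      \<open>4 ^ l / l\<close> choices of \<open>v\<close> meet the endpoint condition, and the
      factor \<open>1 / l\<close> cancels the mean spread of \<open>u\<close>, which is at most
      \<open>l\<close>. The second block is treated symmetrically.\<close>
    have "(\<Sum>u\<in>paths l. \<Sum>v\<in>paths l. \<Sum>w\<in>paths r. ?a u * ?I u v)
        = 4 ^ r * (\<Sum>u\<in>paths l. ?a u * endpoint_count l (y - sum_list u))"
      by (simp add: sum_distrib_left endpoint_count_def algebra_simps eq_diff_eq del: sum_of_bool_eq sum_mult_of_bool_eq sum_of_bool_mult_eq)
    also have "\<dots> \<le> 4 ^ r * (\<Sum>u\<in>paths l. ?a u * (4 ^ l / real l))"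
      by (intro mult_left_mono sum_mono endpoint_count_upper assms(1)) (auto simp: spread_nonneg)
    also have "\<dots> \<le> 4 ^ r * (real l * 4 ^ l * (4 ^ l / real l))"
      unfolding sum_distrib_right[symmetric]
      by (intro mult_left_mono mult_right_mono sum_spread_take_le) auto
    also have "\<dots> = ?N" using assms(1) by (simp add: N)
    finally show "(\<Sum>u\<in>paths l. \<Sum>v\<in>paths l. \<Sum>w\<in>paths r. ?a u * ?I u v) \<le> ?N" .
    have "(\<Sum>u\<in>paths l. \<Sum>v\<in>paths l. \<Sum>w\<in>paths r. ?b v * ?I u v)
        = (\<Sum>v\<in>paths l. \<Sum>u\<in>paths l. \<Sum>w\<in>paths r. ?b v * ?I u v)"
      by (rule sum.swap)
    also have "\<dots> = 4 ^ r * (\<Sum>v\<in>paths l. ?b v * endpoint_count l (y - sum_list v))"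
      by (simp add: sum_distrib_left endpoint_count_def algebra_simps eq_diff_eq del: sum_of_bool_eq sum_mult_of_bool_eq sum_of_bool_mult_eq)
    also have "\<dots> \<le> 4 ^ r * (\<Sum>v\<in>paths l. ?b v * (4 ^ l / real l))"
      by (intro mult_left_mono sum_mono endpoint_count_upper assms(1)) (auto simp: spread_nonneg)
    also have "\<dots> \<le> 4 ^ r * (real l * 4 ^ l * (4 ^ l / real l))"
      unfolding sum_distrib_right[symmetric]
      by (intro mult_left_mono mult_right_mono sum_spread_take_le) auto
    also have "\<dots> = ?N" using assms(1) by (simp add: N)
    finally show "(\<Sum>u\<in>paths l. \<Sum>v\<in>paths l. \<Sum>w\<in>paths r. ?b v * ?I u v) \<le> ?N" .
    \<comment> \<open>The third block is free of the endpoint condition: its mean spread is at most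
      \<open>r\<close>, the condition costs \<open>1 / (2 l)\<close>, and
      \<open>r \<le> 2 * l\<close>.\<close>
    have "(\<Sum>u\<in>paths l. \<Sum>v\<in>paths l. \<Sum>w\<in>paths r. ?c w * ?I u v)
        = (\<Sum>u\<in>paths l. \<Sum>v\<in>paths l. ?I u v) * (\<Sum>w\<in>paths r. ?c w)"
      by (simp only: sum_distrib_right[symmetric] mult.commute[of "sum _ _" "of_bool _"])
    also have "(\<Sum>u\<in>paths l. \<Sum>v\<in>paths l. ?I u v) = endpoint_count (l + l) y"
      unfolding endpoint_count_def sum_paths_append by simp
    also have "endpoint_count (l + l) y * (\<Sum>w\<in>paths r. ?c w) \<le> 4 ^ (l + l) / real (l + l) * (real r * 4 ^ r)"
      using assms(1) by (intro mult_mono endpoint_count_upper sum_spread_take_le sum_nonneg)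
        (auto simp: spread_nonneg)
    also have "\<dots> = ?N * (real r / real (l + l))" by (simp add: N power_add[symmetric])
    also have "\<dots> \<le> ?N * 1" using assms by (intro mult_left_mono) auto
    finally show "(\<Sum>u\<in>paths l. \<Sum>v\<in>paths l. \<Sum>w\<in>paths r. ?c w * ?I u v) \<le> ?N"
      by simp
  qed simp
  finally show ?thesis by simp
qed

section \<open>Visits to a point under the uniform measure\<close>

lemma sum_take_eq_endpoint_count:
  assumes "k \<le> m"
  shows "(\<Sum>g\<in>paths m. of_bool (sum_list (take k g) = y)) = 4 ^ (m - k) * endpoint_count k y"
proof -
  have "(\<Sum>g\<in>paths (k + (m - k)). of_bool (sum_list (take k g) = y))
      = (\<Sum>u\<in>paths k. \<Sum>v\<in>paths (m - k). of_bool (sum_list u = y) :: real)"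
    unfolding sum_paths_append by (intro sum.cong refl) (auto simp: length_paths)
  then show ?thesis using assms
    by (simp add: endpoint_count_def sum_distrib_left)
qed

text \<open>The two visits cut the path into a piece ending at \<open>y\<close>, a loop of length
  \<open>k' - k\<close> and a free remainder. The pieces are independent, and each of the first two
  costs one over its length.\<close>

lemma sum_two_visits_le:
  assumes "0 < k" "k < k'" "k' \<le> m"
  shows "(\<Sum>g\<in>paths m. of_bool (sum_list (take k g) = y) * of_bool (sum_list (take k' g) = y))
    \<le> 4 ^ m / (real k * real (k' - k))"
proof -
  have m: "m = k + ((k' - k) + (m - k'))" using assms by simp
  have "(\<Sum>g\<in>paths m. of_bool (sum_list (take k g) = y) * of_bool (sum_list (take k' g) = y))
      = (\<Sum>u\<in>paths k. \<Sum>v\<in>paths (k' - k). \<Sum>w\<in>paths (m - k').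
          of_bool (sum_list u = y) * of_bool (sum_list v = 0) :: real)"
    by (subst m, unfold sum_paths_append, intro sum.cong refl) (use assms in \<open>auto simp: length_paths\<close>)
  also have "\<dots> = 4 ^ (m - k') * (endpoint_count k y * endpoint_count (k' - k) 0)"
    unfolding endpoint_count_def sum_product
    by (simp add: sum_distrib_left del: sum_of_bool_eq sum_mult_of_bool_eq sum_of_bool_mult_eq)
  also have "\<dots> \<le> 4 ^ (m - k') * (4 ^ k / real k * (4 ^ (k' - k) / real (k' - k)))"
    using assms by (intro mult_left_mono mult_mono endpoint_count_upper endpoint_count_nonneg) auto
  also have "\<dots> = 4 ^ (k + ((k' - k) + (m - k'))) / (real k * real (k' - k))"
    by (simp only: power_add) simp
  also have "\<dots> = 4 ^ m / (real k * real (k' - k))" using m by presburger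
  finally show ?thesis .
qed

section \<open>Low-energy hits under the uniform measure\<close>

text \<open>Each coordinate is a difference of two deviations, since the quarters of the length
  cancel. Hence \<open>x + y\<close> and \<open>x - y\<close> are signed sums of four deviations,
  and Cauchy-Schwarz gives the factor 4. Every step changes \<open>x + y\<close> by an odd amount,
  whence the parity.\<close>

lemma drift_square_le:
  assumes "set g \<subseteq> unit_directions"
  shows "real_of_int (fst (sum_list g) + snd (sum_list g)) ^ 2 \<le> 4 * spread g"
    and "real_of_int (fst (sum_list g) - snd (sum_list g)) ^ 2 \<le> 4 * spread g"
    and "even (fst (sum_list g) + snd (sum_list g) + int (length g))"
proof -
  define a b c d where "a = dev g (1,0)" and "b = dev g (-1,0)" and "c = dev g (0,1)" and "d = dev g (0,-1)"
  have "real_of_int (fst (sum_list g)) = dev g (1,0) - dev g (-1,0)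
      \<and> real_of_int (snd (sum_list g)) = dev g (0,1) - dev g (0,-1)
      \<and> even (fst (sum_list g) + snd (sum_list g) + int (length g))"
    using assms
    by (induction g) (auto simp: dev_def unit_directions_def)
  then have xy: "real_of_int (fst (sum_list g)) = a - b" "real_of_int (snd (sum_list g)) = c - d"
    and ev: "even (fst (sum_list g) + snd (sum_list g) + int (length g))"
    by (auto simp: a_def b_def c_def d_def)
  have s: "spread g = a\<^sup>2 + b\<^sup>2 + c\<^sup>2 + d\<^sup>2"
    by (simp add: spread_def sum_unit_directions a_def b_def c_def d_def)
  \<comment> \<open>The difference of the two sides is the sum of the six squares listed (Lagrange's
    identity).\<close>
  have q: "(p - q + r - t)\<^sup>2 \<le> 4 * (p\<^sup>2 + q\<^sup>2 + r\<^sup>2 + t\<^sup>2)" for p q r t :: real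
    using zero_le_power2[of "p + q"] zero_le_power2[of "p - r"] zero_le_power2[of "p + t"]
      zero_le_power2[of "q + r"] zero_le_power2[of "q - t"] zero_le_power2[of "r + t"]
    by (simp add: power2_eq_square algebra_simps)
  show "real_of_int (fst (sum_list g) + snd (sum_list g)) ^ 2 \<le> 4 * spread g"
    using q[of a b c d] by (simp add: xy s algebra_simps)
  show "real_of_int (fst (sum_list g) - snd (sum_list g)) ^ 2 \<le> 4 * spread g"
    using q[of a b d c] by (simp add: xy s algebra_simps)
  show "even (fst (sum_list g) + snd (sum_list g) + int (length g))" by (rule ev)
qed

text \<open>For \<open>h\<close> and \<open>g\<close> of the same length \<open>n\<close> this has
  order 1 when the spread is of order \<open>n\<close> along \<open>g\<close>. A time average is
  taken rather than a maximum because its mean can be computed term by term; the two terms are those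
  that summation by parts of the log-likelihood produces.\<close>

definition energy :: "(int \<times> int) list \<Rightarrow> (int \<times> int) list \<Rightarrow> real" where
  "energy h g = (\<Sum>j\<le>length g. spread (h @ take j g)) / (real (length h))\<^sup>2
     + spread (h @ g) / real (length h)"

text \<open>Splitting off the history leaves an expression linear in the spreads of prefixes of
  \<open>g\<close>, so that its sum over paths with a prescribed visit is controlled by
  \<open>sum_spread_bridge_le\<close>.\<close>

lemma energy_le:
  assumes "length h = n" "length g = n" "n > 0" "spread h \<le> K * real n"
  shows "energy h g \<le> 6 * K + 2 * ((\<Sum>j\<le>n. spread (take j g)) / (real n)\<^sup>2 + spread g / real n)"
proof -
  have K: "K \<ge> 0" using assms spread_nonneg[of h] by (smt (verit) of_nat_0_less_iff zero_le_mult_iff)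
  have "(\<Sum>j\<le>n. spread (h @ take j g)) \<le> (\<Sum>j\<le>n. 2 * spread h + 2 * spread (take j g))"
    by (intro sum_mono spread_append_le)
  also have "\<dots> = 2 * (real n + 1) * spread h + 2 * (\<Sum>j\<le>n. spread (take j g))"
    by (simp add: sum.distrib sum_distrib_left algebra_simps)
  also have "2 * (real n + 1) * spread h \<le> 2 * (2 * real n) * (K * real n)"
    using assms by (intro mult_mono) (auto simp: spread_nonneg)
  finally have "(\<Sum>j\<le>n. spread (h @ take j g)) / (real n)\<^sup>2
      \<le> (4 * K * (real n)\<^sup>2 + 2 * (\<Sum>j\<le>n. spread (take j g))) / (real n)\<^sup>2"
    by (intro divide_right_mono) (simp_all add: power2_eq_square algebra_simps)
  also have "\<dots> = 4 * K + 2 * ((\<Sum>j\<le>n. spread (take j g)) / (real n)\<^sup>2)"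
    using assms(3) by (simp add: add_divide_distrib)
  finally have 1: "(\<Sum>j\<le>n. spread (h @ take j g)) / (real n)\<^sup>2 \<le> \<dots>" .
  have "spread (h @ g) / real n \<le> (2 * (K * real n) + 2 * spread g) / real n"
    using spread_append_le[of h g] assms(4) by (intro divide_right_mono) auto
  also have "\<dots> = 2 * K + 2 * (spread g / real n)" using assms(3) by (simp add: add_divide_distrib)
  finally have 2: "spread (h @ g) / real n \<le> \<dots>" .
  from 1 2 show ?thesis by (simp add: energy_def assms)
qed

text \<open>Each dyadic block \<open>(2 ^ i, 2 ^ (i + 1)]\<close> contributes at most 1.\<close>

lemma harmonic_le: "(\<Sum>d\<in>{1..2 ^ i}. 1 / real d) \<le> real i + 1"
proof (induction i)
  case (Suc i)
  have "{1..2 ^ Suc i} = {1..2 ^ i} \<union> {2 ^ i<..(2 ^ Suc i :: nat)}" by auto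
  then have "(\<Sum>d\<in>{1..2 ^ Suc i}. 1 / real d)
      = (\<Sum>d\<in>{1..2 ^ i}. 1 / real d) + (\<Sum>d\<in>{2 ^ i<..2 ^ Suc i}. 1 / real d)"
    by (simp only:) (rule sum.union_disjoint; auto)
  also have "(\<Sum>d\<in>{2 ^ i<..2 ^ Suc i}. 1 / real d) \<le> (\<Sum>d\<in>{2 ^ i<..(2 ^ Suc i :: nat)}. 1 / 2 ^ i)"
  proof (intro sum_mono divide_left_mono)
    fix d :: nat assume "d \<in> {2 ^ i<..2 ^ Suc i}"
    then have "2 ^ i \<le> d" by simp
    then show "2 ^ i \<le> real d" by (metis of_nat_le_iff of_nat_numeral of_nat_power)
    then show "0 < real d * 2 ^ i" by (smt (verit) mult_pos_pos zero_less_power)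
  qed simp
  also have "\<dots> = 1" by simp
  finally show ?case using Suc.IH by simp
qed simp

lemma sum_symmetric_square:
  fixes f :: "nat \<Rightarrow> nat \<Rightarrow> real"
  assumes "finite A" and sym: "\<And>a b. f a b = f b a"
  shows "(\<Sum>a\<in>A. \<Sum>b\<in>A. f a b) = (\<Sum>a\<in>A. f a a) + 2 * (\<Sum>a\<in>A. \<Sum>b\<in>{b\<in>A. a < b}. f a b)"
proof -
  have "(\<Sum>b\<in>A. f a b) = f a a + (\<Sum>b\<in>{b\<in>A. a < b}. f a b) + (\<Sum>b\<in>{b\<in>A. b < a}. f a b)"
    if "a \<in> A" for a
  proof -
    have "A = insert a ({b\<in>A. a < b} \<union> {b\<in>A. b < a})" using that by auto
    then have "(\<Sum>b\<in>A. f a b) = (\<Sum>b\<in>insert a ({b\<in>A. a < b} \<union> {b\<in>A. b < a}). f a b)" by simp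
    also have "\<dots> = f a a + ((\<Sum>b\<in>{b\<in>A. a < b}. f a b) + (\<Sum>b\<in>{b\<in>A. b < a}. f a b))"
      using assms(1) by (subst sum.insert, auto, subst sum.union_disjoint, auto)
    finally show ?thesis by simp
  qed
  moreover have "(\<Sum>a\<in>A. \<Sum>b\<in>{b\<in>A. b < a}. f a b) = (\<Sum>a\<in>A. \<Sum>b\<in>{b\<in>A. a < b}. f a b)"
    using sum.swap_restrict[OF assms(1) assms(1), of f "\<lambda>a b. b < a"] sym by simp
  ultimately show ?thesis by (simp add: sum.distrib)
qed

text \<open>Second moment method for \<open>Z\<close>, the number of visits to the origin at the
  times \<open>2 * l\<close>, \<open>q \<le> l < 2 * q\<close>, of the continuation. The history has
  even length, so visits occur at even times only; the times used are all comparable to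
  \<open>q\<close>. Over uniform \<open>g\<close> the mean of \<open>Z\<close> is at least
  \<open>c\<close>, that of \<open>Z\<close> times the energy at most \<open>C\<close>, and that of
  \<open>Z^2\<close> at most \<open>(i + 2) / 2\<close>. The last, logarithmic in \<open>q\<close>,
  reflects the clustering of returns in the plane.\<close>

lemma many_low_energy_hits:
  assumes h: "set h \<subseteq> unit_directions" "length h = 4 * q" and q: "q = 2 ^ i"
    and spread_h: "spread h \<le> K * real (4 * q)" and Kq: "64 * K \<le> real q"
  defines "c \<equiv> exp (- 32 * K) / 8"
  defines "C \<equiv> 3 * K + 27 / 2"
  shows "c\<^sup>2 / (2 * (real i + 2)) * 4 ^ (4 * q) \<le> real (card {g \<in> paths (4 * q).
    energy h g \<le> 2 * C / c \<and> (\<exists>l\<in>{q..<2 * q}. sum_list h + sum_list (take (2 * l) g) = 0)})"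
proof -
  have q0: "q > 0" by (simp add: q)
  have "0 \<le> K * real (4 * q)" using spread_h spread_nonneg[of h] by linarith
  then have K0: "K \<ge> 0" using q0 by (simp add: zero_le_mult_iff)
  have c0: "c > 0" and C0: "C > 0" using K0 by (auto simp: c_def C_def)
  define y where "y = - sum_list h"
  define n where "n = 4 * q"
  let ?N = "4 ^ n :: real"
  have n0: "n > 0" using q0 by (simp add: n_def)
  define V where "V = (\<lambda>l g. of_bool (sum_list (take (2 * l) g) = y) :: real)"
  define Z where "Z = (\<lambda>g. \<Sum>l\<in>{q..<2 * q}. V l g)"
  have V_nonneg: "V l g \<ge> 0" for l g by (simp add: V_def)
  have Z_nonneg: "Z g \<ge> 0" for g by (simp add: Z_def V_nonneg sum_nonneg)
  have V_sum: "(\<Sum>g\<in>paths n. V l g) = 4 ^ (n - 2 * l) * endpoint_count (2 * l) y"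
    if "l \<in> {q..<2 * q}" for l
    unfolding V_def by (rule sum_take_eq_endpoint_count) (use that in \<open>simp add: n_def\<close>)
  have V_sum_le: "(\<Sum>g\<in>paths n. V l g) \<le> ?N / (2 * real q)" if l: "l \<in> {q..<2 * q}" for l
  proof -
    have "(\<Sum>g\<in>paths n. V l g) \<le> 4 ^ (n - 2 * l) * (4 ^ (2 * l) / real (2 * l))"
      unfolding V_sum[OF l] using l q0 by (intro mult_left_mono endpoint_count_upper) auto
    also have "\<dots> = ?N / real (2 * l)" using l by (simp add: power_add[symmetric] n_def)
    also have "\<dots> \<le> ?N / (2 * real q)" using l q0 by (intro divide_left_mono) auto
    finally show ?thesis .
  qed

  have Z_sum: "c * ?N \<le> (\<Sum>g\<in>paths n. Z g)"
  proof -
    \<comment> \<open>The squared rotated coordinates of \<open>y\<close> are at most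
      \<open>4 * spread h\<close>, hence at most \<open>16 * K * l\<close>, so the local bound is
      applied with \<open>16 * K\<close>. This is the source of \<open>exp (- 32 * K)\<close> in
      \<open>c\<close>; the 8 comes from \<open>4 * l < 8 * q\<close>.\<close>
    have low: "c / real q * ?N \<le> (\<Sum>g\<in>paths n. V l g)" if l: "l \<in> {q..<2 * q}" for l
    proof -
      have lq: "4 * spread h \<le> 16 * K * real l"
      proof -
        have "4 * spread h \<le> 16 * K * real q" using spread_h by simp
        also have "\<dots> \<le> 16 * K * real l" using l K0 by (intro mult_left_mono) auto
        finally show ?thesis .
      qed
      have "exp (- 2 * (16 * K)) / (4 * real l) * 4 ^ (2 * l) \<le> endpoint_count (2 * l) (fst y, snd y)"
      proof (rule endpoint_count_lower)
        show "even (fst y + snd y)" using drift_square_le(3)[OF h(1)] h(2) by (simp add: y_def)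
        have "real_of_int (fst y + snd y) ^ 2 = real_of_int (fst (sum_list h) + snd (sum_list h)) ^ 2"
          "real_of_int (fst y - snd y) ^ 2 = real_of_int (fst (sum_list h) - snd (sum_list h)) ^ 2"
          by (simp_all add: y_def power2_eq_square algebra_simps)
        then show "real_of_int (fst y + snd y) ^ 2 \<le> 16 * K * real l"
          "real_of_int (fst y - snd y) ^ 2 \<le> 16 * K * real l"
          using drift_square_le(1,2)[OF h(1)] lq by linarith+
        show "4 * (16 * K) \<le> real l" using Kq l by simp
        show "l > 0" using l q0 by simp
      qed
      then have "4 ^ (n - 2 * l) * (exp (- 32 * K) / (4 * real l) * 4 ^ (2 * l)) \<le> (\<Sum>g\<in>paths n. V l g)"
        unfolding V_sum[OF l] by (intro mult_left_mono) simp_all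
      also have "4 ^ (n - 2 * l) * (exp (- 32 * K) / (4 * real l) * 4 ^ (2 * l))
          = exp (- 32 * K) / (4 * real l) * (4 ^ (n - 2 * l) * 4 ^ (2 * l))"
        by simp
      also have "4 ^ (n - 2 * l) * 4 ^ (2 * l) = ?N" using l by (simp add: power_add[symmetric] n_def)
      finally have "exp (- 32 * K) / (4 * real l) * ?N \<le> (\<Sum>g\<in>paths n. V l g)" .
      moreover have "c / real q \<le> exp (- 32 * K) / (4 * real l)"
        unfolding c_def using l q0 by (simp add: divide_simps)
      ultimately show ?thesis by (smt (verit, best) mult_right_mono zero_less_power)
    qed
    have "c * ?N = (\<Sum>l\<in>{q..<2 * q}. c / real q * ?N)" using q0 by simp
    also have "\<dots> \<le> (\<Sum>l\<in>{q..<2 * q}. \<Sum>g\<in>paths n. V l g)" by (intro sum_mono low)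
    also have "\<dots> = (\<Sum>g\<in>paths n. Z g)" unfolding Z_def by (rule sum.swap)
    finally show ?thesis .
  qed

  \<comment> \<open>Each \<open>l\<close> contributes at most \<open>6 K / (2 q)\<close> from the
    history and \<open>2 * 9 * 3 / n = (27 / 2) / q\<close> from the bridge bound; the
    \<open>q\<close> values of \<open>l\<close> add up to \<open>C\<close>.\<close>
  have Z_energy: "(\<Sum>g\<in>paths n. Z g * energy h g) \<le> C * ?N"
  proof -
    have up: "(\<Sum>g\<in>paths n. V l g * energy h g) \<le> C / real q * ?N" if l: "l \<in> {q..<2 * q}" for l
    proof -
      have bridge: "(\<Sum>g\<in>paths n. spread (take j g) * V l g) \<le> 9 * ?N" for j
        proof -
        have "2 * l + (n - 2 * l) = n" "n - 2 * l \<le> 2 * l" "l > 0" using l q0 by (auto simp: n_def)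
        then show ?thesis using sum_spread_bridge_le[of l "n - 2 * l" j y] unfolding V_def by metis
      qed
      have "(\<Sum>g\<in>paths n. V l g * energy h g)
          \<le> (\<Sum>g\<in>paths n. V l g * (6 * K + 2 * ((\<Sum>j\<le>n. spread (take j g)) / (real n)\<^sup>2 + spread (take n g) / real n)))"
      proof (intro sum_mono mult_left_mono V_nonneg)
        fix g assume "g \<in> paths n"
        then show "energy h g \<le> 6 * K + 2 * ((\<Sum>j\<le>n. spread (take j g)) / (real n)\<^sup>2 + spread (take n g) / real n)"
          using energy_le[of h n g K] h(2) n0 spread_h by (simp add: n_def length_paths)
      qed
      also have "\<dots> = 6 * K * (\<Sum>g\<in>paths n. V l g)
          + 2 * ((\<Sum>j\<le>n. \<Sum>g\<in>paths n. spread (take j g) * V l g) / (real n)\<^sup>2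
            + (\<Sum>g\<in>paths n. spread (take n g) * V l g) / real n)"
      proof -
        have "(\<Sum>j\<le>n. \<Sum>g\<in>paths n. spread (take j g) * V l g)
          = (\<Sum>g\<in>paths n. \<Sum>j\<le>n. spread (take j g) * V l g)" by (rule sum.swap)
        then show ?thesis
          by (simp add: sum.distrib sum_distrib_left sum_distrib_right sum_divide_distrib algebra_simps V_def
              del: sum_of_bool_eq sum_mult_of_bool_eq sum_of_bool_mult_eq)
      qed
      also have "\<dots> \<le> 6 * K * (?N / (2 * real q)) + 2 * ((\<Sum>j\<le>n. 9 * ?N) / (real n)\<^sup>2 + 9 * ?N / real n)"
        using K0 l by (intro add_mono mult_left_mono divide_right_mono sum_mono bridge V_sum_le) auto
      also have "\<dots> = (3 * K / real q + 18 * ((real n + 1) / (real n)\<^sup>2 + 1 / real n)) * ?N"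
        by (simp add: algebra_simps add_divide_distrib)
      also have "\<dots> \<le> C / real q * ?N"
      proof (intro mult_right_mono)
        have "(real n + 1) / (real n)\<^sup>2 \<le> 2 / real n"
          using n0 by (simp add: field_simps power2_eq_square)
        then have "(real n + 1) / (real n)\<^sup>2 + 1 / real n \<le> 2 / real n + 1 / real n"
          by (rule add_right_mono)
        also have "\<dots> = 3 / real n" by (simp add: add_divide_distrib[symmetric])
        finally have "18 * ((real n + 1) / (real n)\<^sup>2 + 1 / real n) \<le> 18 * (3 / real n)"
          by (rule mult_left_mono) simp
        also have "\<dots> = 27 / 2 / real q" by (simp add: n_def)
        finally show "3 * K / real q + 18 * ((real n + 1) / (real n)\<^sup>2 + 1 / real n) \<le> C / real q"
          by (simp add: C_def add_divide_distrib)
      qed simp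
      finally show ?thesis .
    qed
    have "(\<Sum>g\<in>paths n. Z g * energy h g) = (\<Sum>g\<in>paths n. \<Sum>l\<in>{q..<2 * q}. V l g * energy h g)"
      by (simp add: Z_def sum_distrib_right)
    also have "\<dots> = (\<Sum>l\<in>{q..<2 * q}. \<Sum>g\<in>paths n. V l g * energy h g)" by (rule sum.swap)
    also have "\<dots> \<le> (\<Sum>l\<in>{q..<2 * q}. C / real q * ?N)" by (intro sum_mono up)
    also have "\<dots> = C * ?N" using q0 by simp
    finally show ?thesis .
  qed

  \<comment> \<open>The diagonal gives at most \<open>1 / 2\<close>. For fixed \<open>a\<close> the
    gaps \<open>b - a\<close> are distinct and at most \<open>q = 2 ^ i\<close>, so the harmonic sum
    bounds the rest by \<open>(i + 1) / 2\<close>.\<close>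
  have Z_square: "(\<Sum>g\<in>paths n. (Z g)\<^sup>2) \<le> (real i + 2) / 2 * ?N"
  proof -
    let ?P = "\<lambda>a b. \<Sum>g\<in>paths n. V a g * V b g"
    have two: "?P a b \<le> ?N / (4 * real q) * (1 / real (b - a))"
      if "a \<in> {q..<2 * q}" "b \<in> {q..<2 * q}" "a < b" for a b
    proof -
      have "?P a b \<le> ?N / (real (2 * a) * real (2 * b - 2 * a))"
        unfolding V_def using that q0 by (intro sum_two_visits_le) (auto simp: n_def)
      also have "\<dots> = ?N / (4 * real a) * (1 / real (b - a))" using that by (simp add: of_nat_diff)
      also have "\<dots> \<le> ?N / (4 * real q) * (1 / real (b - a))"
        using that q0 by (intro mult_right_mono divide_left_mono) auto
      finally show ?thesis .
    qed
    have inner: "(\<Sum>b\<in>{b\<in>{q..<2 * q}. a < b}. ?P a b) \<le> ?N / (4 * real q) * (real i + 1)"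
      if a: "a \<in> {q..<2 * q}" for a
    proof -
      have "(\<Sum>b\<in>{b\<in>{q..<2 * q}. a < b}. 1 / real (b - a))
          = (\<Sum>d\<in>(\<lambda>b. b - a) ` {b\<in>{q..<2 * q}. a < b}. 1 / real d)"
        by (subst sum.reindex) (auto simp: inj_on_def)
      also have "\<dots> \<le> (\<Sum>d\<in>{1..2 ^ i}. 1 / real d)"
        using a by (intro sum_mono2) (auto simp: q)
      also have "\<dots> \<le> real i + 1" by (rule harmonic_le)
      finally have harm: "(\<Sum>b\<in>{b\<in>{q..<2 * q}. a < b}. 1 / real (b - a)) \<le> real i + 1" .
      have "(\<Sum>b\<in>{b\<in>{q..<2 * q}. a < b}. ?P a b)
          \<le> (\<Sum>b\<in>{b\<in>{q..<2 * q}. a < b}. ?N / (4 * real q) * (1 / real (b - a)))"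
        using a by (intro sum_mono two) auto
      also have "\<dots> = ?N / (4 * real q) * (\<Sum>b\<in>{b\<in>{q..<2 * q}. a < b}. 1 / real (b - a))"
        by (simp add: sum_distrib_left)
      also have "\<dots> \<le> ?N / (4 * real q) * (real i + 1)"
        by (rule mult_left_mono[OF harm]) simp
      finally show ?thesis .
    qed
    have "(\<Sum>g\<in>paths n. (Z g)\<^sup>2) = (\<Sum>g\<in>paths n. \<Sum>a\<in>{q..<2 * q}. \<Sum>b\<in>{q..<2 * q}. V a g * V b g)"
      by (simp add: Z_def power2_eq_square sum_product)
    also have "\<dots> = (\<Sum>a\<in>{q..<2 * q}. \<Sum>b\<in>{q..<2 * q}. ?P a b)"
      by (subst sum.swap, intro sum.cong refl, rule sum.swap)
    also have "\<dots> = (\<Sum>a\<in>{q..<2 * q}. ?P a a) + 2 * (\<Sum>a\<in>{q..<2 * q}. \<Sum>b\<in>{b\<in>{q..<2 * q}. a < b}. ?P a b)"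
      by (rule sum_symmetric_square) (simp_all add: mult.commute)
    also have "\<dots> \<le> (\<Sum>a\<in>{q..<2 * q}. ?N / (2 * real q))
        + 2 * (\<Sum>a\<in>{q..<2 * q}. ?N / (4 * real q) * (real i + 1))"
    proof (intro add_mono mult_left_mono sum_mono inner)
      fix a assume a: "a \<in> {q..<2 * q}"
      have "?P a a = (\<Sum>g\<in>paths n. V a g)" by (intro sum.cong refl) (simp add: V_def)
      then show "?P a a \<le> ?N / (2 * real q)" using V_sum_le[OF a] by simp
    qed simp_all
    also have "\<dots> = (real i + 2) / 2 * ?N" using q0 by (simp add: field_simps)
    finally show ?thesis .
  qed

  \<comment> \<open>Markov's inequality dictates the threshold: paths of energy above
    \<open>E\<close> carry at most \<open>C / E = c / 2\<close> of the mean of \<open>Z\<close>, so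
    at least \<open>c / 2\<close> remains on \<open>G\<close>.\<close>
  define E where "E = 2 * C / c"
  have E0: "E > 0" using c0 C0 by (simp add: E_def)
  define G where "G = {g \<in> paths n. energy h g \<le> E \<and> Z g \<noteq> 0}"
  have Z_good: "c / 2 * ?N \<le> (\<Sum>g\<in>G. Z g * 1)"
  proof -
    have "(\<Sum>g\<in>paths n. Z g) \<le> (\<Sum>g\<in>paths n. (if g \<in> G then Z g else 0) + Z g * energy h g / E)"
    proof (intro sum_mono)
      fix g assume g: "g \<in> paths n"
      show "Z g \<le> (if g \<in> G then Z g else 0) + Z g * energy h g / E"
      proof (cases "energy h g \<le> E")
        case True
        have "energy h g \<ge> 0"
          unfolding energy_def by (intro add_nonneg_nonneg divide_nonneg_nonneg sum_nonneg spread_nonneg) auto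
        then show ?thesis using True g Z_nonneg[of g] E0 by (auto simp: G_def)
      next
        case False
        then have "Z g * E \<le> Z g * energy h g" by (intro mult_left_mono) (auto simp: Z_nonneg)
        then show ?thesis using E0 False by (simp add: G_def field_simps)
      qed
    qed
    also have "\<dots> = (\<Sum>g\<in>G. Z g) + (\<Sum>g\<in>paths n. Z g * energy h g) / E"
      by (simp add: sum.distrib sum_divide_distrib sum.If_cases G_def Int_def conj_commute cong: conj_cong)
    also have "\<dots> \<le> (\<Sum>g\<in>G. Z g) + C * ?N / E"
      using Z_energy E0 by (intro add_left_mono divide_right_mono) auto
    also have "C * ?N / E = c / 2 * ?N" using c0 C0 by (simp add: E_def)
    finally show ?thesis using Z_sum by simp
  qed
  \<comment> \<open>Cauchy-Schwarz turns the mean of \<open>Z\<close> on \<open>G\<close> into a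
    count: \<open>(c / 2)^2\<close> is at most \<open>(i + 2) / 2\<close> times the proportion of
    paths in \<open>G\<close>.\<close>
  have "(c / 2 * ?N)\<^sup>2 \<le> (\<Sum>g\<in>G. Z g * 1)\<^sup>2"
    using Z_good c0 by (intro power_mono) auto
  also have "\<dots> \<le> (\<Sum>g\<in>G. (Z g)\<^sup>2) * (\<Sum>g\<in>G. 1\<^sup>2)"
    by (rule Cauchy_Schwarz_ineq_sum)
  also have "\<dots> \<le> ((real i + 2) / 2 * ?N) * real (card G)"
  proof (intro mult_mono)
    have "(\<Sum>g\<in>G. (Z g)\<^sup>2) \<le> (\<Sum>g\<in>paths n. (Z g)\<^sup>2)" by (intro sum_mono2) (auto simp: G_def)
    then show "(\<Sum>g\<in>G. (Z g)\<^sup>2) \<le> (real i + 2) / 2 * ?N" using Z_square by linarith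
  qed simp_all
  finally have "(c\<^sup>2 / 4 * ?N) * ?N \<le> ((real i + 2) / 2 * real (card G)) * ?N"
    by (simp add: power2_eq_square mult_ac)
  then have "c\<^sup>2 / 4 * ?N \<le> (real i + 2) / 2 * real (card G)"
    by (rule mult_right_le_imp_le) simp
  then have "c\<^sup>2 / (2 * (real i + 2)) * ?N \<le> real (card G)"
    by (simp add: field_simps)
  moreover have "G \<subseteq> {g \<in> paths (4 * q). energy h g \<le> 2 * C / c
      \<and> (\<exists>l\<in>{q..<2 * q}. sum_list h + sum_list (take (2 * l) g) = 0)}"
  proof
    fix g assume g: "g \<in> G"
    then have "Z g \<noteq> 0" by (simp add: G_def)
    then obtain l where l: "l \<in> {q..<2 * q}" "V l g \<noteq> 0"
      unfolding Z_def by (rule sum.not_neutral_contains_not_neutral)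
    then have "sum_list h + sum_list (take (2 * l) g) = 0" by (simp add: V_def y_def)
    with g show "g \<in> {g \<in> paths (4 * q). energy h g \<le> 2 * C / c
      \<and> (\<exists>l\<in>{q..<2 * q}. sum_list h + sum_list (take (2 * l) g) = 0)}"
      using l(1) by (auto simp: G_def E_def n_def)
  qed
  then have "card G \<le> card {g \<in> paths (4 * q). energy h g \<le> 2 * C / c
      \<and> (\<exists>l\<in>{q..<2 * q}. sum_list h + sum_list (take (2 * l) g) = 0)}"
    by (intro card_mono) auto
  ultimately show ?thesis unfolding n_def by linarith
qed

section \<open>Path weights and the likelihood ratio\<close>

definition step_prob :: "real \<Rightarrow> (int \<times> int) list \<Rightarrow> int \<times> int \<Rightarrow> real" where
  "step_prob \<alpha> g e = 1 / 4 + \<alpha> * (dev g e / real (length g))"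

text \<open>This is the probability under the elephant law that the first steps form
  \<open>g\<close>, as \<open>prob_cylinder\<close> shows. Division by zero makes the first factor
  \<open>1 / 4\<close>.\<close>

definition weight :: "real \<Rightarrow> (int \<times> int) list \<Rightarrow> real" where
  "weight \<alpha> g = (\<Prod>j<length g. step_prob \<alpha> (take j g) (g ! j))"

lemma weight_Nil [simp]: "weight \<alpha> [] = 1"
  by (simp add: weight_def)

lemma weight_append:
  "weight \<alpha> (h @ g) = weight \<alpha> h * (\<Prod>j<length g. step_prob \<alpha> (h @ take j g) (g ! j))"
proof (induction g rule: rev_induct)
  case (snoc e g)
  have w: "weight \<alpha> (u @ [e]) = weight \<alpha> u * step_prob \<alpha> u e" for u
    by (simp add: weight_def nth_append)
  show ?case
    using snoc.IH w[of "h @ g"] by (simp add: nth_append mult.assoc)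
qed simp

lemma weight_snoc: "weight \<alpha> (g @ [e]) = weight \<alpha> g * step_prob \<alpha> g e"
  by (simp add: weight_append)

text \<open>For nonempty \<open>g\<close>, \<open>4 * step_prob\<close> is affine in the centered
  proportion \<open>p\<close>, which lies in \<open>[-1/4, 3/4]\<close>; its values at the ends are
  \<open>1 - \<alpha>\<close> and \<open>1 + 3 * \<alpha>\<close>, both positive in the given range
  of \<alpha>.\<close>

lemma step_prob_lower:
  assumes "- 1 / 3 < \<alpha>" "\<alpha> < 1"
  shows "min (1 - \<alpha>) (1 + 3 * \<alpha>) \<le> 4 * step_prob \<alpha> g e"
proof (cases "g = []")
  case False
  define p where "p = dev g e / real (length g)"
  have "p = real (count_list g e) / real (length g) - 1 / 4"
    using False by (simp add: p_def dev_def diff_divide_distrib)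
  moreover have "0 \<le> real (count_list g e) / real (length g)" "real (count_list g e) / real (length g) \<le> 1"
    using count_le_length[of g e] by (auto simp: divide_le_eq_1)
  ultimately have p: "- 1 / 4 \<le> p" "p \<le> 3 / 4" by linarith+
  have "min (1 - \<alpha>) (1 + 3 * \<alpha>) \<le> 1 + 4 * (\<alpha> * p)"
  proof (cases "\<alpha> \<ge> 0")
    case True
    then have "\<alpha> * (- 1 / 4) \<le> \<alpha> * p" using p by (intro mult_left_mono) auto
    then show ?thesis by simp
  next
    case False
    then have "\<alpha> * (3 / 4) \<le> \<alpha> * p" using p by (intro mult_left_mono_neg) auto
    then show ?thesis by simp
  qed
  then show ?thesis by (simp add: step_prob_def p_def)
qed (use assms in \<open>auto simp: step_prob_def\<close>)

lemma step_prob_pos: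
  assumes "- 1 / 3 < \<alpha>" "\<alpha> < 1"
  shows "step_prob \<alpha> g e > 0"
  using step_prob_lower[OF assms, of g e] assms by linarith

lemma weight_pos:
  assumes "- 1 / 3 < \<alpha>" "\<alpha> < 1"
  shows "weight \<alpha> g > 0"
  unfolding weight_def by (intro prod_pos ballI step_prob_pos assms)

lemma sum_step_prob:
  assumes "set g \<subseteq> unit_directions"
  shows "(\<Sum>e\<in>unit_directions. step_prob \<alpha> g e) = 1"
  by (simp add: step_prob_def sum.distrib sum_distrib_left[symmetric] sum_divide_distrib[symmetric]
      sum_dev[OF assms])

section \<open>Total mass and second moment under the elephant law\<close>

lemma sum_weight_append:
  assumes "set h \<subseteq> unit_directions"
  shows "(\<Sum>g\<in>paths m. weight \<alpha> (h @ g)) = weight \<alpha> h"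
proof (induction m)
  case (Suc m)
  have "(\<Sum>g\<in>paths (Suc m). weight \<alpha> (h @ g))
      = (\<Sum>g\<in>paths m. weight \<alpha> (h @ g) * (\<Sum>e\<in>unit_directions. step_prob \<alpha> (h @ g) e))"
    unfolding sum_paths_snoc append_assoc[symmetric] weight_snoc by (simp add: sum_distrib_left)
  also have "\<dots> = (\<Sum>g\<in>paths m. weight \<alpha> (h @ g) * 1)"
    by (intro sum.cong refl arg_cong2[where f = "(*)"] sum_step_prob) (use assms in \<open>auto simp: paths_def\<close>)
  finally show ?case using Suc.IH by simp
qed simp

text \<open>By \<open>spread_snoc\<close> the conditional mean of the next spread is
  \<open>(1 + 2 * \<alpha> / n) * spread g + 3 / 4\<close>. For \<open>n > 0\<close> a bound
  \<open>C * n\<close> propagates once \<open>C * (1 - 2 * \<alpha>)\<close> is at least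
  \<open>3 / 4\<close>, and such a \<open>C\<close> exists in the diffusive regime.\<close>

lemma sum_weight_spread_le:
  assumes "- 1 / 3 < \<alpha>" "\<alpha> < 1 / 2"
  shows "(\<Sum>g\<in>paths n. weight \<alpha> g * spread g) \<le> 3 / (1 - 2 * \<alpha>) * real n"
proof (induction n)
  case (Suc n)
  \<comment> \<open>The numerator 3 in place of \<open>3 / 4\<close> leaves room for
    \<open>n = 0\<close>, where \<open>C \<ge> 3 / 4\<close> is required although
    \<open>1 - 2 * \<alpha>\<close> may exceed 1.\<close>
  define C where "C = 3 / (1 - 2 * \<alpha>)"
  have C: "C * (1 - 2 * \<alpha>) = 3" proof -
    have "1 - 2 * \<alpha> \<noteq> 0" using assms by simp
    then show ?thesis using nonzero_eq_divide_eq C_def by blast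
  qed
  have step: "(\<Sum>e\<in>unit_directions. step_prob \<alpha> g e * (spread g + 2 * dev g e + 3 / 4))
      = (1 + 2 * \<alpha> / real n) * spread g + 3 / 4" if g: "g \<in> paths n" for g
  proof -
    have set: "set g \<subseteq> unit_directions" and len: "length g = n" using g by (auto simp: paths_def)
    have "(\<Sum>e\<in>unit_directions. step_prob \<alpha> g e * (spread g + 2 * dev g e + 3 / 4))
        = (\<Sum>e\<in>unit_directions. step_prob \<alpha> g e * (spread g + 3 / 4)
            + (dev g e * (1 / 2) + 2 * \<alpha> / real n * (dev g e)\<^sup>2))"
      by (intro sum.cong refl) (simp add: step_prob_def len power2_eq_square algebra_simps)
    also have "\<dots> = (\<Sum>e\<in>unit_directions. step_prob \<alpha> g e) * (spread g + 3 / 4)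
        + ((\<Sum>e\<in>unit_directions. dev g e) * (1 / 2) + 2 * \<alpha> / real n * spread g)"
      by (simp only: sum.distrib sum_distrib_right sum_distrib_left spread_def)
    finally show ?thesis by (simp add: sum_dev[OF set] sum_step_prob[OF set] algebra_simps)
  qed
  have "(\<Sum>g\<in>paths (Suc n). weight \<alpha> g * spread g)
      = (\<Sum>g\<in>paths n. \<Sum>e\<in>unit_directions. weight \<alpha> g * (step_prob \<alpha> g e * (spread g + 2 * dev g e + 3 / 4)))"
    unfolding sum_paths_snoc weight_snoc
    by (intro sum.cong refl) (auto simp: paths_def spread_snoc)
  also have "\<dots> = (\<Sum>g\<in>paths n. weight \<alpha> g * ((1 + 2 * \<alpha> / real n) * spread g + 3 / 4))"
    by (simp only: sum_distrib_left[symmetric]) (intro sum.cong refl, simp add: step)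
  also have "\<dots> = (1 + 2 * \<alpha> / real n) * (\<Sum>g\<in>paths n. weight \<alpha> g * spread g) + 3 / 4 * (\<Sum>g\<in>paths n. weight \<alpha> ([] @ g))"
    by (simp add: sum.distrib sum_distrib_left algebra_simps)
  also have "(\<Sum>g\<in>paths n. weight \<alpha> ([] @ g)) = 1" by (subst sum_weight_append) auto
  also have "(1 + 2 * \<alpha> / real n) * (\<Sum>g\<in>paths n. weight \<alpha> g * spread g) \<le> (1 + 2 * \<alpha> / real n) * (C * real n)"
  proof (intro mult_left_mono)
    show "0 \<le> 1 + 2 * \<alpha> / real n" using assms by (cases "n = 0") (auto simp: field_simps)
  qed (use Suc.IH C_def in simp)
  also have "(1 + 2 * \<alpha> / real n) * (C * real n) + 3 / 4 * 1 \<le> C * real (Suc n)"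
  proof (cases "n = 0")
    case False
    then have "(1 + 2 * \<alpha> / real n) * (C * real n) = C * real n + 2 * \<alpha> * C" by (simp add: field_simps)
    then show ?thesis using C by (simp add: algebra_simps)
  next
    case True
    have "C \<ge> 3 / 4" using assms by (simp add: C_def pos_le_divide_eq)
    then show ?thesis using True by simp
  qed
  finally show ?case by (simp add: C_def)
qed simp

text \<open>For \<open>x \<ge> - 1 / 2\<close> the coefficient 2 already suffices in the expansion
  of \<open>ln (1 + x)\<close>. Further left \<open>x^2\<close> exceeds \<open>1 / 4\<close>, and
  the term \<open>4 * ln \<delta>\<close> brings the exponent below
  \<open>ln \<delta>\<close>.\<close>

lemma exp_quadratic_le:
  fixes x \<delta> :: real
  assumes "0 < \<delta>" "\<delta> \<le> 1" "\<delta> \<le> 1 + x"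
  shows "exp (x - (2 - 4 * ln \<delta>) * x\<^sup>2) \<le> 1 + x"
proof -
  define B where "B = 2 - 4 * ln \<delta>"
  have "ln \<delta> \<le> 0" using assms by simp
  then have B: "B \<ge> 2" by (simp add: B_def)
  have Bx: "2 * x\<^sup>2 \<le> B * x\<^sup>2" using B by (intro mult_right_mono) auto
  consider "x > 1" | "0 \<le> x" "x \<le> 1" | "- 1 / 2 \<le> x" "x < 0" | "x < - 1 / 2" by linarith
  then have "exp (x - B * x\<^sup>2) \<le> 1 + x"
  proof cases
    case 1
    then have "x \<le> x\<^sup>2" by (simp add: power2_eq_square)
    then have "x - B * x\<^sup>2 \<le> 0" using Bx 1 by linarith
    then have "exp (x - B * x\<^sup>2) \<le> 1" by simp
    then show ?thesis using 1 by linarith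
  next
    case 2
    then have "x - x\<^sup>2 \<le> ln (1 + x)" by (rule ln_one_plus_pos_lower_bound)
    then have "x - B * x\<^sup>2 \<le> ln (1 + x)" using Bx zero_le_power2[of x] by linarith
    then have "exp (x - B * x\<^sup>2) \<le> exp (ln (1 + x))" by simp
    then show ?thesis using 2 by simp
  next
    case 3
    then have "- (- x) - 2 * (- x)\<^sup>2 \<le> ln (1 - (- x))" by (intro ln_one_minus_pos_lower_bound) auto
    then have "x - B * x\<^sup>2 \<le> ln (1 + x)" using Bx by simp
    then have "exp (x - B * x\<^sup>2) \<le> exp (ln (1 + x))" by simp
    then show ?thesis using 3 by simp
  next
    case 4
    have "(1 / 2)\<^sup>2 \<le> (- x)\<^sup>2" using 4 by (intro power_mono) auto
    then have "B * (1 / 4) \<le> B * x\<^sup>2" using B by (intro mult_left_mono) (auto simp: power2_eq_square)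
    then have "x - B * x\<^sup>2 \<le> ln \<delta>" using 4 by (simp add: B_def)
    then have "exp (x - B * x\<^sup>2) \<le> exp (ln \<delta>)" by simp
    then show ?thesis using assms by simp
  qed
  then show ?thesis by (simp add: B_def)
qed

text \<open>Abel summation, with
  \<open>1 / (n + j) - 1 / (n + j + 1) = 1 / ((n + j) (n + j + 1))\<close>.\<close>

lemma sum_increments_by_parts:
  fixes V :: "nat \<Rightarrow> real"
  assumes "n > 0"
  shows "(\<Sum>j<m. (V (Suc j) - V j) / real (n + j))
    = V m / real (n + m) - V 0 / real n + (\<Sum>j<m. V (Suc j) / (real (n + j) * real (n + Suc j)))"
proof (induction m)
  case (Suc m)
  have "(V (Suc m) - V m) / real (n + m) + V m / real (n + m)
      = V (Suc m) / real (n + Suc m) + V (Suc m) / (real (n + m) * real (n + Suc m))"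
    using assms by (simp add: divide_simps) (simp add: algebra_simps)
  with Suc.IH show ?case by simp
qed simp

text \<open>The drift of the log-likelihood telescopes: the deviation in the direction of a step is
  half the increment of the spread, up to a constant.\<close>

lemma weight_append_lower:
  assumes \<alpha>: "- 1 / 3 < \<alpha>" "\<alpha> < 1"
    and h: "set h \<subseteq> unit_directions" "length h = n" and g: "g \<in> paths n" and n0: "n > 0"
    and spread_h: "spread h \<le> K * real n" and energy: "energy h g \<le> E"
  defines "\<delta> \<equiv> min (1 - \<alpha>) (1 + 3 * \<alpha>)"
  shows "weight \<alpha> h * (exp (- 2 * (E + K + 1) - (2 - 4 * ln \<delta>) * (16 * E)) / 4 ^ n) \<le> weight \<alpha> (h @ g)"
proof -
  have len: "length g = n" and gset: "set g \<subseteq> unit_directions" using g by (auto simp: paths_def)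
  define B where "B = 2 - 4 * ln \<delta>"
  have \<delta>: "0 < \<delta>" "\<delta> \<le> 1" using \<alpha> by (auto simp: \<delta>_def)
  then have "ln \<delta> \<le> 0" by simp
  then have B: "B \<ge> 0" by (simp add: B_def)
  define V where "V = (\<lambda>j. spread (h @ take j g))"
  define d where "d = (\<lambda>j. dev (h @ take j g) (g ! j))"
  \<comment> \<open>\<open>1 + x j\<close> is the likelihood ratio of step \<open>j\<close> against
    the uniform measure.\<close>
  define x where "x = (\<lambda>j. 4 * \<alpha> * (d j / real (n + j)))"
  have V_nonneg: "V j \<ge> 0" for j by (simp add: V_def spread_nonneg)
  have E: "(\<Sum>j\<le>n. V j) / (real n)\<^sup>2 + V n / real n \<le> E"
    using energy by (simp add: energy_def h len V_def)
  have sets: "set (h @ take j g) \<subseteq> unit_directions" for j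
    using h gset set_take_subset[of j g] by auto
  have dir: "g ! j \<in> unit_directions" if "j < n" for j using that len gset nth_mem by blast
  have d_eq: "d j = (V (Suc j) - V j - 3 / 4) / 2" if "j < n" for j
    using spread_snoc[OF sets dir[OF that], of j] that
    by (simp add: V_def d_def take_Suc_conv_app_nth len)
  have d_sq: "(d j)\<^sup>2 \<le> V j" if "j < n" for j
    unfolding d_def V_def spread_def by (rule member_le_sum) (use dir[OF that] in auto)
  have x_eq: "4 * step_prob \<alpha> (h @ take j g) (g ! j) = 1 + x j" if "j < n" for j
    using that by (simp add: step_prob_def x_def d_def h len)
  \<comment> \<open>Summation by parts leaves a final boundary term and a weighted sum, together at
    most \<open>E\<close>, and an initial term at most \<open>K\<close>; the constants
    \<open>3 / 4\<close> in the increments add at most 1. The prefactor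
    \<open>4 * |\<alpha>| / 2\<close> is at most 2.\<close>
  have lin: "- 2 * (E + K + 1) \<le> (\<Sum>j<n. x j)"
  proof -
    have "(a - 3 / 4) / 2 / r = a / r / 2 - 3 / 8 / r" for a r :: real
      by (simp add: diff_divide_distrib)
    then have "(\<Sum>j<n. d j / real (n + j)) = (\<Sum>j<n. ((V (Suc j) - V j) / real (n + j)) / 2 - 3 / 8 / real (n + j))"
      by (intro sum.cong refl) (simp add: d_eq del: of_nat_add)
    also have "\<dots> = (\<Sum>j<n. (V (Suc j) - V j) / real (n + j)) / 2 - (\<Sum>j<n. 3 / 8 / real (n + j))"
      by (simp only: sum_subtractf sum_divide_distrib)
    finally have s: "(\<Sum>j<n. d j / real (n + j)) = \<dots>" .
    have "(\<Sum>j<n. 3 / 8 / real (n + j)) \<le> (\<Sum>j<n. 3 / 8 / real n)"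
      using n0 by (intro sum_mono divide_left_mono) auto
    then have c1: "(\<Sum>j<n. 3 / 8 / real (n + j)) \<le> 1 / 2" using n0 by simp
    have c0: "0 \<le> (\<Sum>j<n. 3 / 8 / real (n + j))" by (intro sum_nonneg) auto
    define S where "S = (\<Sum>j<n. V (Suc j) / (real (n + j) * real (n + Suc j)))"
    have S0: "S \<ge> 0" unfolding S_def by (intro sum_nonneg) (auto simp: V_nonneg)
    have "S \<le> (\<Sum>j<n. V (Suc j) / (real n)\<^sup>2)"
      unfolding S_def power2_eq_square using n0
      by (intro sum_mono divide_left_mono mult_mono) (auto simp: V_nonneg)
    also have "\<dots> = (\<Sum>j\<in>{1..n}. V j) / (real n)\<^sup>2"
      by (simp add: sum_divide_distrib sum.atLeast1_atMost_eq)
    also have "\<dots> \<le> (\<Sum>j\<le>n. V j) / (real n)\<^sup>2"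
      by (intro divide_right_mono sum_mono2) (auto simp: V_nonneg)
    finally have S1: "S \<le> (\<Sum>j\<le>n. V j) / (real n)\<^sup>2" .
    have "V 0 / real n \<le> K" "0 \<le> V 0 / real n"
      using spread_h n0 V_nonneg[of 0] by (auto simp: V_def divide_le_eq)
    moreover have "V n / real (n + n) \<le> V n / real n" "0 \<le> V n / real (n + n)"
      using n0 V_nonneg[of n] by (auto intro!: divide_left_mono)
    moreover note sum_increments_by_parts[OF n0, of V n, folded S_def]
    ultimately have "\<bar>\<Sum>j<n. (V (Suc j) - V j) / real (n + j)\<bar> \<le> E + K"
      using S0 S1 E by linarith
    then have "\<bar>2 * (\<Sum>j<n. d j / real (n + j))\<bar> \<le> E + K + 1"
      using s c0 c1 by (simp add: abs_le_iff del: of_nat_add)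
    then have "\<bar>\<Sum>j<n. d j / real (n + j)\<bar> \<le> (E + K + 1) / 2" by simp
    then have "\<bar>4 * \<alpha>\<bar> * \<bar>\<Sum>j<n. d j / real (n + j)\<bar> \<le> 4 * ((E + K + 1) / 2)"
      using \<alpha> by (intro mult_mono) auto
    then have "\<bar>\<Sum>j<n. x j\<bar> \<le> 2 * (E + K + 1)"
      unfolding x_def sum_distrib_left[symmetric] abs_mult by simp
    then show ?thesis by linarith
  qed
  \<comment> \<open>One squared deviation is at most the spread and
    \<open>|\<alpha>| \<le> 1\<close>, so the squares are covered by 16 times the first term of the
    energy.\<close>
  have quad: "(\<Sum>j<n. (x j)\<^sup>2) \<le> 16 * E"
  proof -
    have "(\<Sum>j<n. (x j)\<^sup>2) \<le> (\<Sum>j<n. 16 * (V j / (real n)\<^sup>2))"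
    proof (intro sum_mono)
      fix j assume j: "j \<in> {..<n}"
      have "\<bar>\<alpha>\<bar> \<le> 1" using \<alpha> by linarith
      then have \<alpha>2: "\<alpha>\<^sup>2 \<le> 1" by (simp add: abs_square_le_1)
      have "(x j)\<^sup>2 = 16 * \<alpha>\<^sup>2 * ((d j)\<^sup>2 / (real (n + j))\<^sup>2)"
        by (simp add: x_def power_mult_distrib power_divide)
      also have "\<dots> \<le> 16 * 1 * (V j / (real n)\<^sup>2)"
        using j n0 \<alpha>2 d_sq[of j] V_nonneg[of j]
        by (intro mult_mono frac_le power_mono) auto
      finally show "(x j)\<^sup>2 \<le> 16 * (V j / (real n)\<^sup>2)" by simp
    qed
    also have "\<dots> = 16 * ((\<Sum>j<n. V j) / (real n)\<^sup>2)" by (simp add: sum_distrib_left sum_divide_distrib)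
    also have "\<dots> \<le> 16 * E"
    proof -
      have "(\<Sum>j<n. V j) / (real n)\<^sup>2 \<le> (\<Sum>j\<le>n. V j) / (real n)\<^sup>2"
        by (intro divide_right_mono sum_mono2) (auto simp: V_nonneg)
      moreover have "0 \<le> V n / real n" by (simp add: V_nonneg)
      ultimately show ?thesis using E by linarith
    qed
    finally show ?thesis .
  qed
  have "exp (- 2 * (E + K + 1) - B * (16 * E)) / 4 ^ n \<le> exp ((\<Sum>j<n. x j) - B * (\<Sum>j<n. (x j)\<^sup>2)) / 4 ^ n"
    using lin mult_left_mono[OF quad B] by (intro divide_right_mono) auto
  also have "\<dots> = (\<Prod>j<n. exp (x j - B * (x j)\<^sup>2) / 4)"
    by (simp add: exp_sum sum_distrib_left sum_subtractf[symmetric] prod_dividef)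
  also have "\<dots> \<le> (\<Prod>j<n. step_prob \<alpha> (h @ take j g) (g ! j))"
  proof (intro prod_mono conjI)
    fix j assume "j \<in> {..<n}"
    then have j: "j < n" by simp
    have "\<delta> \<le> 1 + x j" unfolding x_eq[OF j, symmetric] \<delta>_def by (rule step_prob_lower[OF \<alpha>])
    then have "exp (x j - B * (x j)\<^sup>2) \<le> 1 + x j"
      unfolding B_def by (intro exp_quadratic_le \<delta>)
    then show "exp (x j - B * (x j)\<^sup>2) / 4 \<le> step_prob \<alpha> (h @ take j g) (g ! j)"
      using x_eq[OF j] by simp
  qed simp
  finally have "exp (- 2 * (E + K + 1) - B * (16 * E)) / 4 ^ n \<le> (\<Prod>j<n. step_prob \<alpha> (h @ take j g) (g ! j))" .
  then have "weight \<alpha> h * (exp (- 2 * (E + K + 1) - B * (16 * E)) / 4 ^ n)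
      \<le> weight \<alpha> h * (\<Prod>j<n. step_prob \<alpha> (h @ take j g) (g ! j))"
    using weight_pos[OF \<alpha>, of h] by (intro mult_left_mono) auto
  then show ?thesis by (simp add: weight_append len B_def)
qed

section \<open>Decay of the avoidance probability\<close>

definition avoids_origin :: "nat \<Rightarrow> (int \<times> int) list \<Rightarrow> bool" where
  "avoids_origin m g \<longleftrightarrow> (\<forall>k. m \<le> k \<longrightarrow> k \<le> length g \<longrightarrow> sum_list (take k g) \<noteq> 0)"

definition avoidance_prob :: "real \<Rightarrow> nat \<Rightarrow> nat \<Rightarrow> real" where
  "avoidance_prob \<alpha> m n = (\<Sum>g | g \<in> paths n \<and> avoids_origin m g. weight \<alpha> g)"

lemma avoidance_prob_nonneg:
  assumes "- 1 / 3 < \<alpha>" "\<alpha> < 1"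
  shows "avoidance_prob \<alpha> m n \<ge> 0"
  unfolding avoidance_prob_def by (intro sum_nonneg less_imp_le weight_pos assms)

lemma sum_weight_large_spread:
  assumes "- 1 / 3 < \<alpha>" "\<alpha> < 1 / 2" "K > 0" "n > 0"
  shows "(\<Sum>g | g \<in> paths n \<and> K * real n < spread g. weight \<alpha> g) \<le> 3 / (1 - 2 * \<alpha>) / K"
proof -
  have w: "weight \<alpha> g \<ge> 0" for g using weight_pos[of \<alpha> g] assms by simp
  have "K * real n * (\<Sum>g | g \<in> paths n \<and> K * real n < spread g. weight \<alpha> g)
      \<le> (\<Sum>g | g \<in> paths n \<and> K * real n < spread g. weight \<alpha> g * spread g)"
    unfolding sum_distrib_left
    by (intro sum_mono) (metis (mono_tags, lifting) less_imp_le mem_Collect_eq mult.commute mult_left_mono w)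
  also have "\<dots> \<le> (\<Sum>g\<in>paths n. weight \<alpha> g * spread g)"
    by (intro sum_mono2) (auto simp: w spread_nonneg)
  also have "\<dots> \<le> 3 / (1 - 2 * \<alpha>) * real n"
    by (rule sum_weight_spread_le[OF assms(1,2)])
  finally have "real n * (K * (\<Sum>g | g \<in> paths n \<and> K * real n < spread g. weight \<alpha> g))
      \<le> real n * (3 / (1 - 2 * \<alpha>))"
    by (simp only: mult_ac)
  then have "K * (\<Sum>g | g \<in> paths n \<and> K * real n < spread g. weight \<alpha> g) \<le> 3 / (1 - 2 * \<alpha>)"
    using assms(4) by (simp only: mult_le_cancel_left_pos of_nat_0_less_iff)
  then show ?thesis using assms(3) by (simp only: pos_le_divide_eq mult.commute)
qed

text \<open>Let \<open>n = 4 * 2 ^ i\<close>. From a history with spread at most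
  \<open>K * n\<close> the walk hits the origin before \<open>2 * n\<close> with probability at
  least \<open>b / (i + 2)\<close>: a share \<open>c^2 / (2 (i + 2))\<close> of the continuations
  are low-energy hits, each of conditional probability at least \<open>L / 4 ^ n\<close>. The other
  histories have mass at most \<open>3 / (1 - 2 * \<alpha>) / K\<close>. It matters that
  \<open>b\<close> does not depend on the scale \<open>i\<close>.\<close>

lemma avoidance_prob_doubling:
  assumes \<alpha>: "- 1 / 3 < \<alpha>" "\<alpha> < 1 / 2" and K: "K > 0"
  obtains b where "b > 0"
    "\<And>i m. 64 * K \<le> 2 ^ i \<Longrightarrow> m \<le> 4 * 2 ^ i \<Longrightarrow> avoidance_prob \<alpha> m (2 * (4 * 2 ^ i))
      \<le> avoidance_prob \<alpha> m (4 * 2 ^ i)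
        - b / (real i + 2) * (avoidance_prob \<alpha> m (4 * 2 ^ i) - 3 / (1 - 2 * \<alpha>) / K)"
proof -
  have \<alpha>1: "\<alpha> < 1" using \<alpha> by simp
  note w_pos = weight_pos[OF \<alpha>(1) \<alpha>1]
  define c where "c = exp (- 32 * K) / 8"
  define E where "E = 2 * (3 * K + 27 / 2) / c"
  define \<delta> where "\<delta> = min (1 - \<alpha>) (1 + 3 * \<alpha>)"
  define L where "L = exp (- 2 * (E + K + 1) - (2 - 4 * ln \<delta>) * (16 * E))"
  define b where "b = L * (c\<^sup>2 / 2)"
  have c0: "c > 0" by (simp add: c_def)
  have b0: "b > 0" using c0 by (simp add: b_def L_def)
  have "avoidance_prob \<alpha> m (2 * (4 * 2 ^ i)) \<le> avoidance_prob \<alpha> m (4 * 2 ^ i)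
      - b / (real i + 2) * (avoidance_prob \<alpha> m (4 * 2 ^ i) - 3 / (1 - 2 * \<alpha>) / K)"
    if Kq: "64 * K \<le> 2 ^ i" and m: "m \<le> 4 * 2 ^ i" for i m
  proof -
    define q :: nat where "q = 2 ^ i"
    define n where "n = 4 * q"
    have n0: "n > 0" by (simp add: n_def q_def)
    have mn: "m \<le> n" using m by (simp add: n_def q_def)
    define hits where "hits = (\<lambda>h. {g \<in> paths n. \<exists>l\<in>{q..<2 * q}. sum_list h + sum_list (take (2 * l) g) = 0})"
    define P where "P = {h. h \<in> paths n \<and> avoids_origin m h}"
    define good where "good = {h \<in> P. spread h \<le> K * real n}"
    have fin: "finite P" "finite (hits h)" for h by (auto simp: P_def hits_def)
    have hit_prob: "weight \<alpha> h * (b / (real i + 2)) \<le> (\<Sum>g\<in>hits h. weight \<alpha> (h @ g))" if "h \<in> good" for h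
    proof -
      have h: "set h \<subseteq> unit_directions" "length h = n" "spread h \<le> K * real n"
        using that by (auto simp: good_def P_def paths_def)
      define G where "G = {g \<in> paths n. energy h g \<le> E \<and> (\<exists>l\<in>{q..<2 * q}. sum_list h + sum_list (take (2 * l) g) = 0)}"
      have G: "c\<^sup>2 / (2 * (real i + 2)) * 4 ^ n \<le> real (card G)"
        using many_low_energy_hits[of h q i K] h Kq
        by (simp add: n_def q_def G_def c_def E_def)
      have "weight \<alpha> h * (b / (real i + 2)) = c\<^sup>2 / (2 * (real i + 2)) * 4 ^ n * (weight \<alpha> h * (L / 4 ^ n))"
        by (simp add: b_def)
      also have "\<dots> \<le> real (card G) * (weight \<alpha> h * (L / 4 ^ n))"
        using w_pos[of h] by (intro mult_right_mono G) (simp add: L_def)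
      also have "\<dots> = (\<Sum>g\<in>G. weight \<alpha> h * (L / 4 ^ n))" by simp
      also have "\<dots> \<le> (\<Sum>g\<in>G. weight \<alpha> (h @ g))"
        unfolding L_def \<delta>_def
        by (intro sum_mono weight_append_lower \<alpha> \<alpha>1 h n0) (auto simp: G_def)
      also have "\<dots> \<le> (\<Sum>g\<in>hits h. weight \<alpha> (h @ g))"
        using fin by (intro sum_mono2) (auto simp: G_def hits_def less_imp_le[OF w_pos])
      finally show ?thesis .
    qed
    \<comment> \<open>Step \<open>2 * l\<close> of the continuation is time \<open>n + 2 * l\<close>
      of the whole path, which is at least \<open>m\<close> because
      \<open>m \<le> n\<close>.\<close>
    have avoid: "avoids_origin m h \<and> g \<notin> hits h"
      if "h \<in> paths n" "g \<in> paths n" "avoids_origin m (h @ g)" for h g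
    proof
      have len: "length h = n" "length g = n" using that length_paths by auto
      show "avoids_origin m h"
        unfolding avoids_origin_def
      proof (intro allI impI)
        fix k assume "m \<le> k" "k \<le> length h"
        then show "sum_list (take k h) \<noteq> 0"
          using that(3) unfolding avoids_origin_def by (metis diff_is_0_eq le_add1 length_append order_trans self_append_conv take0 take_append)
      qed
      show "g \<notin> hits h"
      proof
        assume "g \<in> hits h"
        then obtain l where l: "l \<in> {q..<2 * q}" "sum_list h + sum_list (take (2 * l) g) = 0"
          by (auto simp: hits_def)
        have "sum_list (take (n + 2 * l) (h @ g)) = 0" using l len by simp
        moreover have "m \<le> n + 2 * l" "n + 2 * l \<le> length (h @ g)" using l mn len by (auto simp: n_def)
        ultimately show False using that(3) unfolding avoids_origin_def by blast
      qed
    qed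
    have "avoidance_prob \<alpha> m (2 * n) = (\<Sum>g\<in>paths (n + n). if avoids_origin m g then weight \<alpha> g else 0)"
      unfolding avoidance_prob_def mult_2 by (simp add: sum.inter_filter[symmetric])
    also have "\<dots> = (\<Sum>h\<in>paths n. \<Sum>g\<in>paths n. if avoids_origin m (h @ g) then weight \<alpha> (h @ g) else 0)"
      by (rule sum_paths_append)
    also have "\<dots> \<le> (\<Sum>h\<in>paths n. if h \<in> P then \<Sum>g\<in>paths n - hits h. weight \<alpha> (h @ g) else 0)"
    proof (intro sum_mono)
      fix h assume h: "h \<in> paths n"
      show "(\<Sum>g\<in>paths n. if avoids_origin m (h @ g) then weight \<alpha> (h @ g) else 0)
          \<le> (if h \<in> P then \<Sum>g\<in>paths n - hits h. weight \<alpha> (h @ g) else 0)"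
      proof (cases "h \<in> P")
        case True
        have "(\<Sum>g\<in>paths n. if avoids_origin m (h @ g) then weight \<alpha> (h @ g) else 0)
          = (\<Sum>g | g \<in> paths n \<and> avoids_origin m (h @ g). weight \<alpha> (h @ g))"
          by (simp add: sum.inter_filter[symmetric])
        also have "\<dots> \<le> (\<Sum>g\<in>paths n - hits h. weight \<alpha> (h @ g))"
          using avoid[OF h] by (intro sum_mono2) (auto simp: less_imp_le[OF w_pos])
        finally show ?thesis using True by simp
      next
        case False
        then have "\<not> avoids_origin m (h @ g)" if "g \<in> paths n" for g
          using avoid[OF h that] h by (auto simp: P_def)
        then show ?thesis using False by simp
      qed
    qed
    also have "\<dots> = (\<Sum>h\<in>P. \<Sum>g\<in>paths n - hits h. weight \<alpha> (h @ g))"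
      by (simp add: sum.inter_filter[symmetric] P_def)
    also have "\<dots> = (\<Sum>h\<in>P. weight \<alpha> h - (\<Sum>g\<in>hits h. weight \<alpha> (h @ g)))"
    proof (intro sum.cong refl)
      fix h assume "h \<in> P"
      then have "set h \<subseteq> unit_directions" by (auto simp: P_def paths_def)
      then show "(\<Sum>g\<in>paths n - hits h. weight \<alpha> (h @ g)) = weight \<alpha> h - (\<Sum>g\<in>hits h. weight \<alpha> (h @ g))"
        by (subst sum_diff) (auto simp: hits_def sum_weight_append)
    qed
    also have "\<dots> = avoidance_prob \<alpha> m n - (\<Sum>h\<in>P. \<Sum>g\<in>hits h. weight \<alpha> (h @ g))"
      by (simp add: sum_subtractf avoidance_prob_def P_def)
    also have "\<dots> \<le> avoidance_prob \<alpha> m n - (\<Sum>h\<in>good. weight \<alpha> h * (b / (real i + 2)))"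
    proof -
      have "(\<Sum>h\<in>good. weight \<alpha> h * (b / (real i + 2))) \<le> (\<Sum>h\<in>good. \<Sum>g\<in>hits h. weight \<alpha> (h @ g))"
        by (intro sum_mono hit_prob)
      also have "\<dots> \<le> (\<Sum>h\<in>P. \<Sum>g\<in>hits h. weight \<alpha> (h @ g))"
        using fin by (intro sum_mono2) (auto simp: good_def sum_nonneg less_imp_le[OF w_pos])
      finally show ?thesis by simp
    qed
    also have "\<dots> = avoidance_prob \<alpha> m n - b / (real i + 2) * (\<Sum>h\<in>good. weight \<alpha> h)"
      by (simp add: sum_distrib_left sum_divide_distrib mult.commute)
    also have "\<dots> \<le> avoidance_prob \<alpha> m n - b / (real i + 2) * (avoidance_prob \<alpha> m n - 3 / (1 - 2 * \<alpha>) / K)"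
    proof -
      have "avoidance_prob \<alpha> m n = (\<Sum>h\<in>good. weight \<alpha> h) + (\<Sum>h\<in>P - good. weight \<alpha> h)"
        unfolding avoidance_prob_def P_def[symmetric]
        using fin by (subst add.commute, intro sum.subset_diff) (auto simp: good_def)
      also have "(\<Sum>h\<in>P - good. weight \<alpha> h) \<le> (\<Sum>h | h \<in> paths n \<and> K * real n < spread h. weight \<alpha> h)"
        by (intro sum_mono2) (auto simp: P_def good_def less_imp_le[OF w_pos])
      also have "\<dots> \<le> 3 / (1 - 2 * \<alpha>) / K"
        by (rule sum_weight_large_spread[OF \<alpha> K n0])
      finally have "avoidance_prob \<alpha> m n - 3 / (1 - 2 * \<alpha>) / K \<le> (\<Sum>h\<in>good. weight \<alpha> h)" by simp
      then show ?thesis using b0 by (intro diff_left_mono mult_left_mono) auto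
    qed
    finally show ?thesis by (simp add: n_def q_def)
  qed
  with b0 show ?thesis using that by blast
qed

text \<open>While \<open>u\<close> stays above \<open>2 * \<epsilon>\<close>, each step from
  \<open>i0\<close> on lowers it by at least \<open>b * \<epsilon> / (i + 2)\<close>; divergence of
  the harmonic series then contradicts nonnegativity.\<close>

lemma harmonic_decay:
  fixes u :: "nat \<Rightarrow> real"
  assumes "b > 0" "\<epsilon> > 0" and nonneg: "\<And>i. u i \<ge> 0"
    and step: "\<And>i. i \<ge> i0 \<Longrightarrow> u (Suc i) \<le> u i - b / (real i + 2) * (u i - \<epsilon>)"
  shows "\<exists>i. u i \<le> 2 * \<epsilon>"
proof (rule ccontr)
  assume "\<not> ?thesis"
  then have big: "u i > 2 * \<epsilon>" for i by (simp add: not_le)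
  have "u (i0 + N) \<le> u i0 - b * \<epsilon> * (\<Sum>j<N. 1 / (real (j + i0) + 2))" for N
  proof (induction N)
    case (Suc N)
    have "b / (real (i0 + N) + 2) * \<epsilon> \<le> b / (real (i0 + N) + 2) * (u (i0 + N) - \<epsilon>)"
      using assms(1) big[of "i0 + N"] by (intro mult_left_mono) auto
    with step[of "i0 + N"] Suc.IH show ?case by (simp add: algebra_simps)
  qed simp
  then have "b * \<epsilon> * (\<Sum>j<N. 1 / (real (j + i0) + 2)) \<le> u i0" for N
    by (smt (verit) nonneg)
  then have bound: "(\<Sum>j<N. 1 / (real (j + i0) + 2)) \<le> u i0 / (b * \<epsilon>)" for N
    using assms by (simp add: pos_le_divide_eq mult.commute)
  have "summable (\<lambda>j. 1 / (real (j + i0) + 2))"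
    by (rule summableI_nonneg_bounded[OF _ bound]) simp
  then have "summable (\<lambda>j. inverse (real (j + (i0 + 2))))"
    by (simp add: inverse_eq_divide add_ac)
  then have "summable (\<lambda>j. inverse (real j))" by (subst (asm) summable_iff_shift)
  then show False using not_summable_harmonic[where 'a = real] by blast
qed

lemma avoidance_prob_small:
  assumes \<alpha>: "- 1 / 3 < \<alpha>" "\<alpha> < 1 / 2" and "\<eta> > 0"
  shows "\<exists>n. avoidance_prob \<alpha> m n \<le> \<eta>"
proof -
  define C where "C = 3 / (1 - 2 * \<alpha>)"
  have C0: "C > 0" using \<alpha> by (simp add: C_def)
  \<comment> \<open>Chosen so that twice the exceptional mass \<open>C / K\<close> equals
    \<eta>.\<close>
  define K where "K = 2 * C / \<eta>"
  have K: "K > 0" using C0 assms(3) by (simp add: K_def)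
  obtain b where b: "b > 0" "\<And>i m. 64 * K \<le> 2 ^ i \<Longrightarrow> m \<le> 4 * 2 ^ i \<Longrightarrow>
      avoidance_prob \<alpha> m (2 * (4 * 2 ^ i)) \<le> avoidance_prob \<alpha> m (4 * 2 ^ i)
        - b / (real i + 2) * (avoidance_prob \<alpha> m (4 * 2 ^ i) - C / K)"
    using avoidance_prob_doubling[OF \<alpha> K] unfolding C_def by blast
  \<comment> \<open>From scale \<open>i0\<close> on, the local lower bounds are available and
    \<open>m\<close> lies before the doubling window.\<close>
  obtain i0 :: nat where i0: "64 * K + real m \<le> 2 ^ i0"
    using real_arch_pow[of 2 "64 * K + real m"] by (auto intro: less_imp_le)
  have "\<exists>i. avoidance_prob \<alpha> m (4 * 2 ^ i) \<le> 2 * (C / K)"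
  proof (rule harmonic_decay[OF b(1), where ?i0.0 = i0])
    show "C / K > 0" using C0 K by simp
    show "avoidance_prob \<alpha> m (4 * 2 ^ i) \<ge> 0" for i
      using \<alpha> by (intro avoidance_prob_nonneg) auto
    fix i assume "i \<ge> i0"
    then have "(2::real) ^ i0 \<le> 2 ^ i" by simp
    with i0 K have "64 * K \<le> 2 ^ i" "real m \<le> 2 ^ i" by linarith+
    moreover from this(2) have "m \<le> 2 ^ i" by simp
    then have "m \<le> 4 * 2 ^ i" by linarith
    ultimately show "avoidance_prob \<alpha> m (4 * 2 ^ Suc i) \<le> avoidance_prob \<alpha> m (4 * 2 ^ i)
        - b / (real i + 2) * (avoidance_prob \<alpha> m (4 * 2 ^ i) - C / K)"
      using b(2)[of i m] by (simp add: mult.left_commute)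
  qed
  moreover have "2 * (C / K) = \<eta>" using C0 assms(3) by (simp add: K_def)
  ultimately show ?thesis by auto
qed

section \<open>Recurrence\<close>

context elephant_random_walk
begin

definition steps :: "nat \<Rightarrow> 'a \<Rightarrow> (int \<times> int) list" where
  "steps n \<omega> = map (\<lambda>j. walk_step X j \<omega>) [0..<n]"

lemma length_steps [simp]: "length (steps n \<omega>) = n"
  by (simp add: steps_def)

lemma steps_0 [simp]: "steps 0 \<omega> = []"
  by (simp add: steps_def)

lemma steps_Suc: "steps (Suc n) \<omega> = steps n \<omega> @ [walk_step X n \<omega>]"
  by (simp add: steps_def)

lemma take_steps: "k \<le> n \<Longrightarrow> take k (steps n \<omega>) = steps k \<omega>"
  by (simp add: steps_def take_map)

lemma sum_list_steps: "sum_list (steps n \<omega>) = X n \<omega> - X 0 \<omega>"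
  by (induction n) (simp_all add: steps_Suc walk_step_def)

lemma centered_count_steps: "centered_count X n e \<omega> = dev (steps n \<omega>) e"
proof -
  have "real (count_list (steps n \<omega>) e) = (\<Sum>j<n. if walk_step X j \<omega> = e then 1 else 0)"
    by (induction n) (auto simp: steps_Suc)
  then show ?thesis by (simp add: centered_count_def dev_def)
qed

section \<open>Law of the first steps\<close>

lemma cylinder_in_step_sigma:
  "{\<omega> \<in> space M. steps n \<omega> = g} \<in> sets (step_sigma M X n)"
proof (cases "length g = n")
  case len: True
  have space: "space (step_sigma M X n) = space M"
    using subalgebra_step_sigma by (simp add: subalgebra_def)
  have gen: "walk_step X j -` A \<inter> space M \<in> sets (step_sigma M X n)" if "j < n" for j A
    unfolding step_sigma_def using that by (subst sets_measure_of) auto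
  have iff: "steps n \<omega> = g \<longleftrightarrow> (\<forall>j<n. walk_step X j \<omega> = g ! j)" for \<omega>
    using len by (simp add: list_eq_iff_nth_eq) (simp add: steps_def)
  show ?thesis
  \<comment> \<open>For \<open>n = 0\<close> the intersection over coordinates has an empty index
    set, whereas the cylinder is the whole space.\<close>
  proof (cases "n = 0")
    case True
    then show ?thesis using sets.top[of "step_sigma M X n"] len unfolding space by simp
  next
    case False
    then have "{\<omega> \<in> space M. steps n \<omega> = g} = (\<Inter>j\<in>{..<n}. walk_step X j -` {g ! j} \<inter> space M)"
      unfolding iff by blast
    also have "\<dots> \<in> sets (step_sigma M X n)"
      using False by (intro sets.finite_INT gen) auto
    finally show ?thesis .
  qed
next
  case False
  then have "{\<omega> \<in> space M. steps n \<omega> = g} = {}" by auto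
  then show ?thesis by (simp only: sets.empty_sets)
qed

lemma cylinder_event: "{\<omega> \<in> space M. steps n \<omega> = g} \<in> events"
  using cylinder_in_step_sigma subalgebra_step_sigma[of n] by (auto simp: subalgebra_def)

text \<open>Chain rule: the cylinder of \<open>g\<close> lies in the sigma-field of the first
  \<open>length g\<close> steps, so the indicator of the next step may be replaced there by its
  conditional expectation, which on the cylinder is almost surely the constant
  \<open>step_prob \<alpha> g e\<close>.\<close>

lemma prob_cylinder:
  assumes "set g \<subseteq> unit_directions"
  shows "prob {\<omega> \<in> space M. steps (length g) \<omega> = g} = weight \<alpha> g"
  using assms
proof (induction g rule: rev_induct)
  case Nil
  then show ?case by (simp add: prob_space)
next
  case (snoc e g)
  define n where "n = length g"
  let ?A = "{\<omega> \<in> space M. steps n \<omega> = g}" and ?B = "{\<omega> \<in> space M. walk_step X n \<omega> = e}"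
  interpret sub: finite_measure_subalgebra M "step_sigma M X n"
    by unfold_locales (rule subalgebra_step_sigma)
  have e: "e \<in> unit_directions" using snoc.prems by simp
  have B: "?B \<in> events" by measurable
  have A: "?A \<in> events" by (rule cylinder_event)
  have "prob {\<omega> \<in> space M. steps (length (g @ [e])) \<omega> = g @ [e]} = prob (?A \<inter> ?B)"
    by (intro arg_cong[where f = prob]) (auto simp: n_def steps_Suc)
  also have "\<dots> = (\<integral>\<omega>\<in>?A. indicat_real ?B \<omega> \<partial>M)"
  proof -
    have "prob (?A \<inter> ?B) = (\<integral>\<omega>. indicat_real (?A \<inter> ?B) \<omega> \<partial>M)"
      using A B by simp
    then show ?thesis
      by (simp add: set_lebesgue_integral_def indicator_inter_arith)
  qed
  also have "\<dots> = (\<integral>\<omega>\<in>?A. real_cond_exp M (step_sigma M X n) (indicat_real ?B) \<omega> \<partial>M)"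
    using B by (intro sub.real_cond_exp_intA cylinder_in_step_sigma) (auto simp: less_top[symmetric])
  also have "\<dots> = (\<integral>\<omega>. indicat_real ?A \<omega> * step_prob \<alpha> g e \<partial>M)"
    unfolding set_lebesgue_integral_def
  proof (rule integral_cong_AE)
    show "AE \<omega> in M. indicat_real ?A \<omega> *\<^sub>R real_cond_exp M (step_sigma M X n) (indicat_real ?B) \<omega>
        = indicat_real ?A \<omega> * step_prob \<alpha> g e"
      using step_law[OF e, of n]
      by eventually_elim (auto simp: indicator_def step_prob_def centered_count_steps n_def)
  qed (use A in measurable)
  also have "\<dots> = prob ?A * step_prob \<alpha> g e" using A by simp
  also have "\<dots> = weight \<alpha> (g @ [e])"
    using snoc by (simp add: weight_snoc n_def)
  finally show ?case .
qed

lemma AE_walk_regular: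
  "AE \<omega> in M. X 0 \<omega> = 0 \<and> (\<forall>n. steps n \<omega> \<in> paths n)"
proof -
  have "AE \<omega> in M. \<forall>k. walk_step X k \<omega> \<in> unit_directions"
    using nearest_neighbour by (simp add: AE_all_countable)
  with start_origin show ?thesis
    by eventually_elim (auto simp: paths_def steps_def zero_prod_def)
qed

text \<open>Avoiding the origin forever from time \<open>m\<close> on forces avoidance up to time
  \<open>n\<close>, an event covered by finitely many cylinders. The inclusion holds only almost
  surely, as do the starting point and the nearest-neighbour property.\<close>

lemma prob_avoid_le:
  "prob {\<omega> \<in> space M. \<forall>k\<ge>m. X k \<omega> \<noteq> 0} \<le> avoidance_prob \<alpha> m n"
proof -
  let ?G = "{g. g \<in> paths n \<and> avoids_origin m g}"
  let ?C = "\<lambda>g. {\<omega> \<in> space M. steps n \<omega> = g}"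
  have "prob {\<omega> \<in> space M. \<forall>k\<ge>m. X k \<omega> \<noteq> 0} \<le> prob (\<Union>g\<in>?G. ?C g)"
  proof (rule finite_measure_mono_AE)
    show "AE \<omega> in M. \<omega> \<in> {\<omega> \<in> space M. \<forall>k\<ge>m. X k \<omega> \<noteq> 0} \<longrightarrow> \<omega> \<in> (\<Union>g\<in>?G. ?C g)"
      using AE_walk_regular
      by eventually_elim (auto simp: avoids_origin_def take_steps sum_list_steps)
    show "(\<Union>g\<in>?G. ?C g) \<in> events"
      by (intro sets.finite_UN cylinder_event) auto
  qed
  also have "\<dots> \<le> (\<Sum>g\<in>?G. prob (?C g))"
    by (intro finite_measure_subadditive_finite) (auto intro: cylinder_event)
  also have "\<dots> = avoidance_prob \<alpha> m n"
    unfolding avoidance_prob_def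
    by (intro sum.cong refl) (auto simp: paths_def prob_cylinder[symmetric])
  finally show ?thesis .
qed

end

theorem theorem1p1:
  fixes M :: "'a measure" and \<alpha> :: real and X :: "nat \<Rightarrow> 'a \<Rightarrow> int \<times> int"
  assumes "- 1 / 3 < \<alpha>" and "\<alpha> < 1 / 2"
    and "elephant_random_walk M \<alpha> X"
  shows "AE \<omega> in M. infinite {k. X k \<omega> = (0, 0)}"
proof -
  interpret elephant_random_walk M \<alpha> X by (rule assms(3))
  have event: "{\<omega> \<in> space M. \<forall>k\<ge>m. X k \<omega> \<noteq> 0} \<in> events" for m
  proof -
    have [measurable]: "X k \<in> measurable M (count_space UNIV)" for k by (rule measurable_walk)
    show ?thesis by measurable
  qed
  \<comment> \<open>The horizon \<open>n\<close> is free in \<open>prob_avoid_le\<close>, so for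
    each fixed \<open>m\<close> the bound can be made arbitrarily small.\<close>
  have "prob {\<omega> \<in> space M. \<forall>k\<ge>m. X k \<omega> \<noteq> 0} = 0" for m
  proof (rule antisym)
    show "prob {\<omega> \<in> space M. \<forall>k\<ge>m. X k \<omega> \<noteq> 0} \<le> 0"
    proof (rule field_le_epsilon)
      fix \<eta> :: real assume "\<eta> > 0"
      then obtain n where "avoidance_prob \<alpha> m n \<le> \<eta>"
        using avoidance_prob_small[OF assms(1,2)] by blast
      then show "prob {\<omega> \<in> space M. \<forall>k\<ge>m. X k \<omega> \<noteq> 0} \<le> 0 + \<eta>"
        using prob_avoid_le[of m n] by simp
    qed
  qed simp
  then have "AE \<omega> in M. \<not> (\<forall>k\<ge>m. X k \<omega> \<noteq> 0)" for m
    by (subst AE_iff_measurable[OF event[of m]]) (simp_all add: emeasure_eq_measure)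
  then have "AE \<omega> in M. \<forall>m. \<not> (\<forall>k\<ge>m. X k \<omega> \<noteq> 0)" by (simp add: AE_all_countable)
  then show ?thesis
    by eventually_elim (auto simp: infinite_nat_iff_unbounded_le zero_prod_def)
qed

end
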